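(* Let $n\ge1$ be an integer. If there exists an extension in $\mathrm{Ext}_\lambda(K(S^{2n}),\widetilde K(S^{4n}))$ whose Hopf invariant is odd, then $n=1,2$ or $4$.
   Context: **The $\lambda$-ring and $\lambda$-module.** $K(S^{2n})=\mathbb Z\cdot1\oplus\mathbb Zy$ with $y^2=0$, $\lambda^k(y)=(-1)^{k-1}k^{n-1}y$ for $k\ge 1$, hence Adams operations $\Psi^k(y)=k^ny$. For $n'\ge 1$, $\widetilde K(S^{2n'})=\mathbb Zz$ is the $K(S^{2n})$-module with $y\cdot z=0$ and operations $\Lambda^k(z)=(-1)^{k-1}k^{n'-1}z$ (so $\psi^k(z)=k^{n'}z$). Here $n'=2n$. **$\lambda$-rings** are in the sense of Grothendieck/Atiyah–Tall with all axioms for $\lambda^i(r+s)$, $\lambda^i(rs)$, $\lambda^i(\lambda^j(r))$ and $\lambda_t(1)=1+t$ ("special $\lambda$-rings"). The Adams operations are defined by $\Psi^i(r)-\lambda^1(r)\Psi^{i-1}(r)+\dots+(-1)^{i-1}\lambda^{i-1}(r)\Psi^1(r)+(-1)^ii\lambda^i(r)=0$. **Extensions.** A $\lambda$-module over a $\lambda$-ring $R$ is an $R$-module $M$ with additive maps $\Lambda^i:M\to M$ ($i\ge1$) with $\Lambda^1=\mathrm{id}$, $\Lambda^i(rm)=\Psi^i(r)\Lambda^i(m)$, $\Lambda^{ij}=(-1)^{(i+1)(j+1)}\Lambda^i\Lambda^j$. A $\lambda$-ring extension of $R$ by $M$ is an exact sequence $0\to M\xrightarrow{a}E\xrightarrow{b}R\to0$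 with $E$ a $\lambda$-ring, $b$ a map of $\lambda$-rings, $a$ additive, $x\,a(m)=a(b(x)m)$ for $x\in E$, $m\in M$, and $a\Lambda^i=\lambda^ia$ for $i\ge1$. $\mathrm{Ext}_\lambda(R,M)$ is the set of equivalence classes of extensions under $\lambda$-ring maps of the middle terms inducing identities on $M$ and $R$. **Hopf invariant.** For an extension $E$ of $K(S^{2n})$ by $\widetilde K(S^{2n'})$ let $\alpha=a(z)$ and let $\beta\in E$ satisfy $b(\beta)=y$. Then $\alpha^2=0$, $\alpha\beta=0$ and $\beta^2=h\alpha$ for an integer $h$ independent of the choice of $\beta$; $h$ is the Hopf invariant of the extension. *)

theory Defs
  imports "HOL-Library.Poly_Mapping" "HOL-Computational_Algebra.Polynomial" "HOL-Algebra.Module" "HOL-Algebra.QuotRing"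
begin

section \<open>Integer polynomials in several variables\<close>

text \<open>A monomial is a finitely supported exponent vector. Polynomials are substituted into the
  polynomial rings themselves (type classes) to state identities between them, and evaluated in
  arbitrary commutative rings (locale \<^locale>\<open>cring\<close>) to state the axioms of lambda-rings.\<close>

type_synonym 'v int_poly = "('v \<Rightarrow>\<^sub>0 nat) \<Rightarrow>\<^sub>0 int"

definition poly_var :: "'v \<Rightarrow> 'v int_poly" where
  "poly_var v = Poly_Mapping.single (Poly_Mapping.single v 1) 1"

definition poly_vars :: "'v int_poly \<Rightarrow> 'v set" where
  "poly_vars P = (\<Union>m \<in> Poly_Mapping.keys P. Poly_Mapping.keys m)"

definition poly_subst :: "('v \<Rightarrow> 'c::comm_ring_1) \<Rightarrow> 'v int_poly \<Rightarrow> 'c" where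
  "poly_subst f P = (\<Sum>m \<in> Poly_Mapping.keys P. of_int (Poly_Mapping.lookup P m) *
     (\<Prod>v \<in> Poly_Mapping.keys m. f v ^ Poly_Mapping.lookup m v))"

definition poly_eval :: "('a, 'x) ring_scheme \<Rightarrow> ('v \<Rightarrow> 'a) \<Rightarrow> 'v int_poly \<Rightarrow> 'a" where
  "poly_eval R f P = (\<Oplus>\<^bsub>R\<^esub>m \<in> Poly_Mapping.keys P. [Poly_Mapping.lookup P m] \<cdot>\<^bsub>R\<^esub>
     (\<Otimes>\<^bsub>R\<^esub>v \<in> Poly_Mapping.keys m. f v [^]\<^bsub>R\<^esub> Poly_Mapping.lookup m v))"

definition elem_sym :: "'i set \<Rightarrow> ('i \<Rightarrow> 'c::comm_ring_1) \<Rightarrow> nat \<Rightarrow> 'c" where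
  "elem_sym I f k = (\<Sum>A | A \<subseteq> I \<and> card A = k. \<Prod>i\<in>A. f i)"

text \<open>The universal polynomial \<open>P\<^sub>k(s\<^sub>1, \<dots>, s\<^sub>k; \<sigma>\<^sub>1, \<dots>, \<sigma>\<^sub>k)\<close>, with \<open>Inl i\<close> the variable
  \<open>s\<^sub>i\<close> and \<open>Inr j\<close> the variable \<open>\<sigma>\<^sub>j\<close>: if the \<open>s\<^sub>i\<close> and \<open>\<sigma>\<^sub>j\<close> are the elementary symmetric
  functions of \<open>x\<^sub>1, \<dots>, x\<^sub>k\<close> and of \<open>y\<^sub>1, \<dots>, y\<^sub>k\<close>, it is the coefficient of \<open>t\<^sup>k\<close> in the product of
  all \<open>1 + x\<^sub>i y\<^sub>j t\<close>. By the fundamental theorem on symmetric polynomials exactly one polynomial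
  satisfies the predicate.\<close>

definition is_prod_poly :: "nat \<Rightarrow> (nat + nat) int_poly \<Rightarrow> bool" where
  "is_prod_poly k P \<longleftrightarrow>
     poly_vars P \<subseteq> Inl ` {1..k} \<union> Inr ` {1..k} \<and>
     poly_subst (case_sum (elem_sym {1..k} (\<lambda>i. poly_var (Inl i)))
                          (elem_sym {1..k} (\<lambda>j. poly_var (Inr j)))) P
       = poly.coeff (\<Prod>i\<in>{1..k}. \<Prod>j\<in>{1..k}. [:1, poly_var (Inl i) * poly_var (Inr j) :: (nat + nat) int_poly:]) k"

text \<open>The universal polynomial \<open>P\<^sub>k\<^sub>,\<^sub>l(s\<^sub>1, \<dots>, s\<^sub>k\<^sub>l)\<close>: if the \<open>s\<^sub>i\<close> are the elementary symmetric
  functions of \<open>x\<^sub>1, \<dots>, x\<^sub>k\<^sub>l\<close>, it is the coefficient of \<open>t\<^sup>k\<close> in the product of all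
  \<open>1 + x\<^sub>i\<^sub>1 \<cdots> x\<^sub>i\<^sub>l t\<close> with \<open>i\<^sub>1 < \<dots> < i\<^sub>l\<close>. Again there is exactly one.\<close>

definition is_comp_poly :: "nat \<Rightarrow> nat \<Rightarrow> nat int_poly \<Rightarrow> bool" where
  "is_comp_poly k l P \<longleftrightarrow>
     poly_vars P \<subseteq> {1..k * l} \<and>
     poly_subst (elem_sym {1..k * l} poly_var) P
       = poly.coeff (\<Prod>A | A \<subseteq> {1..k * l} \<and> card A = l. [:1, \<Prod>i\<in>A. poly_var i :: nat int_poly:]) k"


section \<open>Lambda-rings and Adams operations\<close>

record 'a lambda_ring = "'a ring" +
  lam :: "nat \<Rightarrow> 'a \<Rightarrow> 'a"

locale lambda_ring = cring R for R :: "('a, 'x) lambda_ring_scheme" (structure) +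
  assumes lam_closed: "r \<in> carrier R \<Longrightarrow> lam R k r \<in> carrier R"
    and lam_0: "r \<in> carrier R \<Longrightarrow> lam R 0 r = \<one>"
    and lam_1: "r \<in> carrier R \<Longrightarrow> lam R 1 r = r"
    and lam_one: "k \<ge> 2 \<Longrightarrow> lam R k \<one> = \<zero>"
    and lam_add: "\<lbrakk>r \<in> carrier R; s \<in> carrier R\<rbrakk> \<Longrightarrow>
      lam R k (r \<oplus> s) = (\<Oplus>i\<in>{0..k}. lam R i r \<otimes> lam R (k - i) s)"
    and lam_mult: "\<lbrakk>r \<in> carrier R; s \<in> carrier R; is_prod_poly k P\<rbrakk> \<Longrightarrow>
      lam R k (r \<otimes> s) = poly_eval R (case_sum (\<lambda>i. lam R i r) (\<lambda>j. lam R j s)) P"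
    and lam_lam: "\<lbrakk>r \<in> carrier R; is_comp_poly k l Q\<rbrakk> \<Longrightarrow>
      lam R k (lam R l r) = poly_eval R (\<lambda>i. lam R i r) Q"

definition lambda_hom ::
  "('a, 'x) lambda_ring_scheme \<Rightarrow> ('b, 'y) lambda_ring_scheme \<Rightarrow> ('a \<Rightarrow> 'b) set" where
  "lambda_hom R S = {f \<in> ring_hom R S. \<forall>k. \<forall>r\<in>carrier R. f (lam R k r) = lam S k (f r)}"

text \<open>Newton's recursion, solved for the Adams operation of index \<open>i \<ge> 1\<close>. The guard
  \<open>0 < j \<and> j < i\<close> always holds in the range of summation; it only serves the termination proof.
  Lemma \<open>adams_newton\<close> below is the defining relation in its usual form.\<close>

fun adams :: "('a, 'x) lambda_ring_scheme \<Rightarrow> nat \<Rightarrow> 'a \<Rightarrow> 'a" where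
  "adams R i r =
     (\<Oplus>\<^bsub>R\<^esub>j\<in>{1..<i}. if 0 < j \<and> j < i
        then [((-1::int) ^ (j + 1))] \<cdot>\<^bsub>R\<^esub> (lam R j r \<otimes>\<^bsub>R\<^esub> adams R (i - j) r) else \<zero>\<^bsub>R\<^esub>)
     \<oplus>\<^bsub>R\<^esub> [((-1::int) ^ (i + 1) * int i)] \<cdot>\<^bsub>R\<^esub> lam R i r"

declare adams.simps [simp del]

lemma adams_closed:
  assumes "cring R" and "\<And>k. lam R k r \<in> carrier R"
  shows "adams R i r \<in> carrier R"
proof (induction i rule: less_induct)
  case (less i)
  interpret cring R by fact
  show ?case
    by (subst adams.simps) (use less assms(2) in \<open>auto intro!: add.finprod_closed add.int_pow_closed\<close>)
qed

lemma adams_newton: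
  assumes "cring R" and "\<And>k. lam R k r \<in> carrier R"
  shows "adams R i r \<oplus>\<^bsub>R\<^esub> (\<Oplus>\<^bsub>R\<^esub>j\<in>{1..<i}. [((-1::int) ^ j)] \<cdot>\<^bsub>R\<^esub> (lam R j r \<otimes>\<^bsub>R\<^esub> adams R (i - j) r))
     \<oplus>\<^bsub>R\<^esub> [((-1::int) ^ i * int i)] \<cdot>\<^bsub>R\<^esub> lam R i r = \<zero>\<^bsub>R\<^esub>"
proof -
  interpret cring R by fact
  note [simp] = adams_closed[OF assms] assms(2) add.int_pow_closed
  let ?t = "\<lambda>j. lam R j r \<otimes>\<^bsub>R\<^esub> adams R (i - j) r"
  have *: "[(- k)] \<cdot>\<^bsub>R\<^esub> x = \<ominus>\<^bsub>R\<^esub> ([k] \<cdot>\<^bsub>R\<^esub> x)" if "x \<in> carrier R" for k :: int and x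
    using that by (simp add: add.int_pow_neg)
  have "adams R i r = (\<Oplus>\<^bsub>R\<^esub>j\<in>{1..<i}. \<ominus>\<^bsub>R\<^esub> ([((-1::int) ^ j)] \<cdot>\<^bsub>R\<^esub> ?t j))
      \<oplus>\<^bsub>R\<^esub> (\<ominus>\<^bsub>R\<^esub> ([((-1::int) ^ i * int i)] \<cdot>\<^bsub>R\<^esub> lam R i r))"
    by (subst adams.simps) (auto simp: * intro!: arg_cong2[where f = "add R"] add.finprod_cong')
  moreover have "(\<Oplus>\<^bsub>R\<^esub>j\<in>{1..<i}. \<ominus>\<^bsub>R\<^esub> ([((-1::int) ^ j)] \<cdot>\<^bsub>R\<^esub> ?t j))
      \<oplus>\<^bsub>R\<^esub> (\<Oplus>\<^bsub>R\<^esub>j\<in>{1..<i}. [((-1::int) ^ j)] \<cdot>\<^bsub>R\<^esub> ?t j) = \<zero>\<^bsub>R\<^esub>"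
    by (subst add.finprod_multf[symmetric]) (auto simp: l_neg intro!: add.finprod_one_eqI)
  ultimately show ?thesis
    by (simp add: a_ac l_neg r_neg)
qed


section \<open>Lambda-modules and extensions\<close>

record ('a, 'b) lambda_module = "('a, 'b) module" +
  Lam :: "nat \<Rightarrow> 'b \<Rightarrow> 'b"

locale lambda_module = lambda_ring R + module R M
  for R :: "('a, 'x) lambda_ring_scheme" (structure) and M :: "('a, 'm, 'y) lambda_module_scheme" +
  assumes Lam_closed: "\<lbrakk>i \<ge> 1; m \<in> carrier M\<rbrakk> \<Longrightarrow> Lam M i m \<in> carrier M"
    and Lam_add: "\<lbrakk>i \<ge> 1; m \<in> carrier M; m' \<in> carrier M\<rbrakk> \<Longrightarrow>
      Lam M i (m \<oplus>\<^bsub>M\<^esub> m') = Lam M i m \<oplus>\<^bsub>M\<^esub> Lam M i m'"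
    and Lam_1: "m \<in> carrier M \<Longrightarrow> Lam M 1 m = m"
    and Lam_smult: "\<lbrakk>i \<ge> 1; r \<in> carrier R; m \<in> carrier M\<rbrakk> \<Longrightarrow>
      Lam M i (r \<odot>\<^bsub>M\<^esub> m) = adams R i r \<odot>\<^bsub>M\<^esub> Lam M i m"
    and Lam_Lam: "\<lbrakk>i \<ge> 1; j \<ge> 1; m \<in> carrier M\<rbrakk> \<Longrightarrow>
      Lam M (i * j) m = [((-1::int) ^ ((i + 1) * (j + 1)))] \<cdot>\<^bsub>M\<^esub> Lam M i (Lam M j m)"

locale lambda_extension = lambda_module R M + E: lambda_ring E
  for R :: "('r, 'x) lambda_ring_scheme" (structure) and M :: "('r, 'm, 'y) lambda_module_scheme"
    and E :: "'e lambda_ring" and a :: "'m \<Rightarrow> 'e" and b :: "'e \<Rightarrow> 'r" +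
  assumes a_hom: "a \<in> hom (add_monoid M) (add_monoid E)"
    and a_inj: "inj_on a (carrier M)"
    and b_hom: "b \<in> lambda_hom E R"
    and b_surj: "b ` carrier E = carrier R"
    and exact: "a ` carrier M = a_kernel E R b"
    and a_smult: "\<lbrakk>x \<in> carrier E; m \<in> carrier M\<rbrakk> \<Longrightarrow> x \<otimes>\<^bsub>E\<^esub> a m = a (b x \<odot>\<^bsub>M\<^esub> m)"
    and a_Lam: "\<lbrakk>i \<ge> 1; m \<in> carrier M\<rbrakk> \<Longrightarrow> a (Lam M i m) = lam E i (a m)"

text \<open>An extension is a triple \<open>(E, a, b)\<close>. The carrier of \<open>E\<close> is a subset of the type \<open>'e\<close>.\<close>

type_synonym ('r, 'm, 'e) ext = "'e lambda_ring \<times> ('m \<Rightarrow> 'e) \<times> ('e \<Rightarrow> 'r)"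

definition extensions ::
  "('r, 'x) lambda_ring_scheme \<Rightarrow> ('r, 'm, 'y) lambda_module_scheme \<Rightarrow> ('r, 'm, 'e) ext set" where
  "extensions R M = {(E, a, b). lambda_extension R M E a b}"

definition ext_equiv ::
  "('r, 'x) lambda_ring_scheme \<Rightarrow> ('r, 'm, 'y) lambda_module_scheme \<Rightarrow> ('r, 'm, 'e) ext rel" where
  "ext_equiv R M = {((E, a, b), (E', a', b')).
     (E, a, b) \<in> extensions R M \<and> (E', a', b') \<in> extensions R M \<and>
     (\<exists>f \<in> lambda_hom E E'. (\<forall>m\<in>carrier M. f (a m) = a' m) \<and> (\<forall>x\<in>carrier E. b' (f x) = b x))}"

lemma lambda_hom_comp: "f \<in> lambda_hom R S \<Longrightarrow> g \<in> lambda_hom S T \<Longrightarrow> g \<circ> f \<in> lambda_hom R T"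
  unfolding lambda_hom_def by (auto simp: ring_hom_trans dest: ring_hom_closed)

lemma lambda_extension_hom_inverse:
  assumes "lambda_extension R M E a b" "lambda_extension R M E' a' b'"
    and f: "f \<in> lambda_hom E E'" "\<forall>m\<in>carrier M. f (a m) = a' m" "\<forall>x\<in>carrier E. b' (f x) = b x"
  shows "\<exists>g \<in> lambda_hom E' E. (\<forall>m\<in>carrier M. g (a' m) = a m) \<and> (\<forall>x\<in>carrier E'. b (g x) = b' x)"
proof -
  interpret A: lambda_extension R M E a b by fact
  interpret B: lambda_extension R M E' a' b' by fact
  interpret f: ring_hom_cring E E' f
    using f(1) A.E.cring_axioms B.E.cring_axioms by (simp add: ring_hom_cring_def ring_hom_cring_axioms_def lambda_hom_def)
  interpret b: ring_hom_cring E R b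
    using A.b_hom A.E.cring_axioms A.cring_axioms by (simp add: ring_hom_cring_def ring_hom_cring_axioms_def lambda_hom_def)
  interpret b': ring_hom_cring E' R b'
    using B.b_hom B.E.cring_axioms A.cring_axioms by (simp add: ring_hom_cring_def ring_hom_cring_axioms_def lambda_hom_def)
  have f2: "f (a m) = a' m" if "m \<in> carrier M" for m using f(2) that by blast
  have f3: "b' (f x) = b x" if "x \<in> carrier E" for x using f(3) that by blast
  note f = f(1)
  have kerE: "x \<in> a ` carrier M \<longleftrightarrow> x \<in> carrier E \<and> b x = \<zero>\<^bsub>R\<^esub>" for x
    unfolding A.exact a_kernel_def' by blast
  have kerE': "x \<in> a' ` carrier M \<longleftrightarrow> x \<in> carrier E' \<and> b' x = \<zero>\<^bsub>R\<^esub>" for x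
    unfolding B.exact a_kernel_def' by blast
  have a_closed: "a m \<in> carrier E" "b (a m) = \<zero>\<^bsub>R\<^esub>" if "m \<in> carrier M" for m
    using kerE that by blast+
  have a'_zero: "a' \<zero>\<^bsub>M\<^esub> = \<zero>\<^bsub>E'\<^esub>" and a_zero: "a \<zero>\<^bsub>M\<^esub> = \<zero>\<^bsub>E\<^esub>"
    using group_hom.hom_one[of "add_monoid M" "add_monoid E'" a'] B.a_hom
      group_hom.hom_one[of "add_monoid M" "add_monoid E" a] A.a_hom
      A.M.a_group A.E.a_group B.E.a_group
    by (auto simp: group_hom_def group_hom_axioms_def)
  have ker: "x = \<zero>\<^bsub>E\<^esub>" if "x \<in> carrier E" "f x = \<zero>\<^bsub>E'\<^esub>" for x
  proof -
    have "b x = b' (f x)" using f3[OF that(1)] by (rule sym)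
    then have "b x = \<zero>\<^bsub>R\<^esub>" unfolding that(2) b'.hom_zero .
    then have "x \<in> a ` carrier M" using kerE[of x] that(1) by simp
    then obtain m where m: "m \<in> carrier M" "x = a m" by (elim imageE)
    then have "a' m = a' \<zero>\<^bsub>M\<^esub>" using f2[OF m(1)] that(2) a'_zero m(2) by simp
    then have "m = \<zero>\<^bsub>M\<^esub>" by (rule inj_onD[OF B.a_inj _ m(1) A.M.zero_closed])
    then show ?thesis using m(2) a_zero by simp
  qed
  have inj: "inj_on f (carrier E)"
  proof (rule inj_onI)
    fix x y assume xy: "x \<in> carrier E" "y \<in> carrier E" "f x = f y"
    then have "f (x \<ominus>\<^bsub>E\<^esub> y) = \<zero>\<^bsub>E'\<^esub>" by (simp add: a_minus_def B.E.r_neg)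
    then have "x \<ominus>\<^bsub>E\<^esub> y = \<zero>\<^bsub>E\<^esub>" by (intro ker A.E.minus_closed xy)
    moreover have "(x \<ominus>\<^bsub>E\<^esub> y) \<oplus>\<^bsub>E\<^esub> y = x" using xy by (simp add: a_minus_def A.E.a_assoc A.E.l_neg)
    ultimately show "x = y" using xy by simp
  qed
  have surj: "f ` carrier E = carrier E'"
  proof safe
    fix x' assume x': "x' \<in> carrier E'"
    then have "b' x' \<in> b ` carrier E" using A.b_surj by simp
    then obtain x where x: "x \<in> carrier E" "b x = b' x'" by auto
    then have "b' (x' \<ominus>\<^bsub>E'\<^esub> f x) = \<zero>\<^bsub>R\<^esub>" using x' x f3[OF x(1)] abelian_group.r_neg[OF ring.is_abelian_group[OF cring.axioms(1)[OF A.cring_axioms]], of "b' x'"]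
      by (simp add: a_minus_def)
    then have "x' \<ominus>\<^bsub>E'\<^esub> f x \<in> a' ` carrier M" using kerE'[of "x' \<ominus>\<^bsub>E'\<^esub> f x"] x x' by simp
    then obtain m where m: "m \<in> carrier M" "x' \<ominus>\<^bsub>E'\<^esub> f x = f (a m)" using f2 by auto
    have "f (a m \<oplus>\<^bsub>E\<^esub> x) = (x' \<ominus>\<^bsub>E'\<^esub> f x) \<oplus>\<^bsub>E'\<^esub> f x" using m x a_closed by simp
    also have "\<dots> = x'" using x x' by (simp add: a_minus_def B.E.a_assoc B.E.l_neg)
    finally show "x' \<in> f ` carrier E" using x m a_closed by (intro image_eqI[of _ f "a m \<oplus>\<^bsub>E\<^esub> x"]) (simp_all add: a_closed)
  qed simp
  define g where "g = inv_into (carrier E) f"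
  have g_hom: "g \<in> ring_hom E' E"
    unfolding g_def
    using inj surj f.homh ring_iso_set_sym[of E f E'] A.E.ring_axioms
    by (auto simp: ring_iso_def bij_betw_def)
  have gf: "g (f x) = x" if "x \<in> carrier E" for x
    using inj that by (simp add: g_def)
  have fg: "f (g x) = x \<and> g x \<in> carrier E" if "x \<in> carrier E'" for x
    using surj that by (metis f_inv_into_f g_def inv_into_into)
  have "g \<in> lambda_hom E' E"
    unfolding lambda_hom_def
  proof (safe)
    show "g \<in> ring_hom E' E" by fact
    fix k x assume "x \<in> carrier E'"
    then have "lam E' k x = f (lam E k (g x))" using f fg[of x] by (auto simp: lambda_hom_def)
    then show "g (lam E' k x) = lam E k (g x)" using gf fg \<open>x \<in> carrier E'\<close> A.E.lam_closed by simp
  qed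
  moreover have "\<forall>m\<in>carrier M. g (a' m) = a m" using f2 gf a_closed by metis
  moreover have "\<forall>x\<in>carrier E'. b (g x) = b' x" using f3 fg by metis
  ultimately show ?thesis by blast
qed

lemma ext_equiv_equiv: "equiv (extensions R M) (ext_equiv R M)"
proof (rule equivI)
  show "ext_equiv R M \<subseteq> extensions R M \<times> extensions R M" by (auto simp: ext_equiv_def)
  show "refl_on (extensions R M) (ext_equiv R M)"
    by (auto simp: refl_on_def ext_equiv_def lambda_hom_def ring_hom_def intro!: bexI[of _ id])
  show "trans (ext_equiv R M)"
  proof (rule transI)
    fix u v w assume "(u, v) \<in> ext_equiv R M" "(v, w) \<in> ext_equiv R M"
    then obtain E a b E' a' b' E'' a'' b'' f g
      where u: "u = (E, a, b)" "v = (E', a', b')" "w = (E'', a'', b'')"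
      and e: "u \<in> extensions R M" "w \<in> extensions R M"
      and f: "f \<in> lambda_hom E E'" "\<forall>m\<in>carrier M. f (a m) = a' m" "\<forall>x\<in>carrier E. b' (f x) = b x"
      and g: "g \<in> lambda_hom E' E''" "\<forall>m\<in>carrier M. g (a' m) = a'' m" "\<forall>x\<in>carrier E'. b'' (g x) = b' x"
      unfolding ext_equiv_def by blast
    have "f x \<in> carrier E'" if "x \<in> carrier E" for x
      using f(1) that by (auto simp: lambda_hom_def ring_hom_closed)
    then show "(u, w) \<in> ext_equiv R M"
      using e f g lambda_hom_comp[OF f(1) g(1)] unfolding ext_equiv_def u
      by (auto intro!: bexI[of _ "g \<circ> f"])
  qed
  show "sym (ext_equiv R M)"
  proof (rule symI)
    fix u v assume "(u, v) \<in> ext_equiv R M"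
    then obtain E a b E' a' b' f
      where u: "u = (E, a, b)" "v = (E', a', b')"
      and e: "u \<in> extensions R M" "v \<in> extensions R M"
      and f: "f \<in> lambda_hom E E'" "\<forall>m\<in>carrier M. f (a m) = a' m" "\<forall>x\<in>carrier E. b' (f x) = b x"
      unfolding ext_equiv_def by blast
    then show "(v, u) \<in> ext_equiv R M"
      using lambda_extension_hom_inverse[of R M E a b E' a' b' f] f by (auto simp: ext_equiv_def extensions_def)
  qed
qed

definition Ext_lambda ::
  "('r, 'x) lambda_ring_scheme \<Rightarrow> ('r, 'm, 'y) lambda_module_scheme \<Rightarrow> ('r, 'm, 'e) ext set set" where
  "Ext_lambda R M = extensions R M // ext_equiv R M"


section \<open>K-theory of spheres\<close>

definition int_choose :: "int \<Rightarrow> nat \<Rightarrow> int" where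
  "int_choose p k = (\<Prod>i = 0..<k. p - int i) div fact k"

text \<open>The pair \<open>(p, q)\<close> stands for \<open>p \<cdot> 1 + q \<cdot> y\<close> in \<open>K(S\<^sup>2\<^sup>n)\<close>, where \<open>y\<^sup>2 = 0\<close>. Multiplicativity of
  \<open>\<lambda>\<^sub>t\<close> forces \<open>\<lambda>\<^sub>t(p + q y) = (1 + t)\<^sup>p (1 + q (\<Sum>\<^sub>j\<^sub>\<ge>\<^sub>1 (-1)\<^sup>j\<^sup>-\<^sup>1 j\<^sup>n\<^sup>-\<^sup>1 t\<^sup>j) y)\<close>.\<close>

definition K_sphere :: "nat \<Rightarrow> (int \<times> int) lambda_ring" where
  "K_sphere n = \<lparr>carrier = UNIV,
     mult = (\<lambda>(p, q) (p', q'). (p * p', p * q' + q * p')),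
     one = (1, 0), zero = (0, 0),
     add = (\<lambda>(p, q) (p', q'). (p + p', q + q')),
     lam = (\<lambda>k (p, q). (int_choose p k,
       q * (\<Sum>j\<in>{1..k}. (-1) ^ (j - 1) * int j ^ (n - 1) * int_choose p (k - j))))\<rparr>"

text \<open>The reduced group of \<open>S\<^sup>2\<^sup>n\<close>, with the generator \<open>z\<close> as \<open>1 :: int\<close> and with \<open>y\<close> acting as \<open>0\<close>. The
  fields \<open>mult\<close> and \<open>one\<close> are part of every module record but play no role for modules.\<close>

definition K_sphere_red :: "nat \<Rightarrow> (int \<times> int, int) lambda_module" where
  "K_sphere_red n = \<lparr>carrier = UNIV, mult = (\<lambda>_ _. 0), one = 0, zero = 0, add = (+),
     smult = (\<lambda>(p, q) m. p * m),
     Lam = (\<lambda>k m. (-1) ^ (k - 1) * int k ^ (n - 1) * m)\<rparr>"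

lemma K_sphere_cring: "cring (K_sphere n)"
proof (rule cringI)
  show "abelian_group (K_sphere n)"
    by (rule abelian_groupI) (auto simp: K_sphere_def intro!: exI[of _ "- _"])
  show "comm_monoid (K_sphere n)"
    by (rule comm_monoidI) (auto simp: K_sphere_def algebra_simps)
qed (auto simp: K_sphere_def algebra_simps)

lemma K_sphere_red_module: "module (K_sphere n) (K_sphere_red n')"
proof (rule moduleI[OF K_sphere_cring])
  show "abelian_group (K_sphere_red n')"
    by (rule abelian_groupI) (auto simp: K_sphere_red_def intro!: exI[of _ "- _"])
qed (auto simp: K_sphere_def K_sphere_red_def algebra_simps)

lemma K_sphere_lam_y:
  assumes "k \<ge> 1"
  shows "lam (K_sphere n) k (0, 1) = (0, (-1) ^ (k - 1) * int k ^ (n - 1))"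
proof -
  have "int_choose 0 m = (if m = 0 then 1 else 0)" for m
    by (cases m) (auto simp: int_choose_def prod.atLeast0_lessThan_Suc_shift simp del: prod.op_ivl_Suc)
  then have "(\<Sum>j\<in>{1..k}. (-1) ^ (j - 1) * int j ^ (n - 1) * int_choose 0 (k - j)) =
    (\<Sum>j\<in>{1..k}. if j = k then (-1) ^ (k - 1) * int k ^ (n - 1) else 0)"
    by (intro sum.cong) auto
  with assms \<open>\<And>m. int_choose 0 m = _ m\<close> show ?thesis
    by (simp add: K_sphere_def)
qed

text \<open>The integer \<open>h\<close> with \<open>\<beta>\<^sup>2 = h \<alpha>\<close>, where \<open>\<alpha> = a(z)\<close> and \<open>\<beta>\<close> is any lift of \<open>y\<close>.\<close>

definition hopf_invariant :: "(int \<times> int, int, 'e) ext \<Rightarrow> int" where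
  "hopf_invariant = (\<lambda>(E, a, b). THE h.
     \<forall>\<beta>\<in>carrier E. b \<beta> = (0, 1) \<longrightarrow> \<beta> \<otimes>\<^bsub>E\<^esub> \<beta> = [h] \<cdot>\<^bsub>E\<^esub> a 1)"

end

theory Submission
  imports Defs
begin

text \<open>The Adams--Atiyah argument, with the commutation of the Adams operations of index 2 and 3 replaced
  by its source. Write \<open>\<lambda>\<^sup>k(\<beta>) = s\<^sub>k \<beta> + c\<^sub>k \<alpha>\<close> with \<open>s\<^sub>k = (-1)\<^sup>k\<^sup>-\<^sup>1 k\<^sup>n\<^sup>-\<^sup>1\<close>. Both \<open>\<lambda>\<^sup>2(\<lambda>\<^sup>3(\<beta>))\<close> and
  \<open>\<lambda>\<^sup>3(\<lambda>\<^sup>2(\<beta>))\<close> can be computed from additivity and from the universal polynomials; eliminating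
  \<open>c\<^sub>6\<close> from the two resulting relations shows that \<open>3\<^sup>n\<^sup>-\<^sup>1 (3\<^sup>n - 1) (h - 2 c\<^sub>2)\<close> is divisible by \<open>2\<^sup>n\<close>.
  For odd \<open>h\<close> this means that \<open>2\<^sup>n\<close> divides \<open>3\<^sup>n - 1\<close>, which happens only for \<open>n = 1, 2, 4\<close>.\<close>

section \<open>Evaluation of integer polynomials\<close>

text \<open>Keys can cancel in a sum of polynomials, so the sums over keys are compared on a common
  finite superset, where the extra terms have coefficient zero. \<open>poly_eval_superset\<close>
  serves the same purpose in a ring with carrier.\<close>

lemma poly_subst_superset:
  assumes "finite S" "Poly_Mapping.keys P \<subseteq> S"
  shows "poly_subst f P = (\<Sum>m\<in>S. of_int (Poly_Mapping.lookup P m) *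
    (\<Prod>v \<in> Poly_Mapping.keys m. f v ^ Poly_Mapping.lookup m v))"
  unfolding poly_subst_def using assms
  by (intro sum.mono_neutral_left) (auto simp: in_keys_iff)

lemma poly_subst_add: "poly_subst f (P + Q) = poly_subst f P + poly_subst f Q"
proof -
  let ?S = "Poly_Mapping.keys P \<union> Poly_Mapping.keys Q"
  have "Poly_Mapping.keys (P + Q) \<subseteq> ?S" by (rule Poly_Mapping.keys_add)
  then show ?thesis
    by (simp add: poly_subst_superset[of ?S] lookup_add distrib_right sum.distrib)
qed

lemma poly_subst_single: "poly_subst f (Poly_Mapping.single m c) =
    of_int c * (\<Prod>v \<in> Poly_Mapping.keys m. f v ^ Poly_Mapping.lookup m v)"
  by (subst poly_subst_superset[of "{m}"]) auto

lemma power_prod_superset: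
  fixes f :: "'v \<Rightarrow> 'c::comm_ring_1"
  assumes "finite S" "Poly_Mapping.keys m \<subseteq> S"
  shows "(\<Prod>v \<in> Poly_Mapping.keys m. f v ^ Poly_Mapping.lookup m v) = (\<Prod>v\<in>S. f v ^ Poly_Mapping.lookup m v)"
  using assms by (intro prod.mono_neutral_left) (auto simp: in_keys_iff)

lemma power_prod_add:
  fixes f :: "'v \<Rightarrow> 'c::comm_ring_1"
  shows "(\<Prod>v \<in> Poly_Mapping.keys (m + m'). f v ^ Poly_Mapping.lookup (m + m') v) =
    (\<Prod>v \<in> Poly_Mapping.keys m. f v ^ Poly_Mapping.lookup m v) *
    (\<Prod>v \<in> Poly_Mapping.keys m'. f v ^ Poly_Mapping.lookup m' v)"
proof -
  let ?S = "Poly_Mapping.keys m \<union> Poly_Mapping.keys m'"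
  have sub: "Poly_Mapping.keys (m + m') \<subseteq> ?S" by (rule Poly_Mapping.keys_add)
  have fin: "finite ?S" by simp
  show ?thesis
    unfolding power_prod_superset[OF fin sub] power_prod_superset[OF fin Un_upper1]
      power_prod_superset[OF fin Un_upper2]
    by (simp only: lookup_add power_add prod.distrib)
qed

lemma power_prod_single:
  fixes f :: "'v \<Rightarrow> 'c::comm_ring_1"
  shows "(\<Prod>u \<in> Poly_Mapping.keys (Poly_Mapping.single v k). f u ^ Poly_Mapping.lookup (Poly_Mapping.single v k) u) = f v ^ k"
  by (subst power_prod_superset[of "{v}"]) auto

context cring
begin

lemma int_pow_0_add: "[(0::int)] \<cdot> x = \<zero>"
  by (simp add: add_pow_def int_pow_def)

lemma poly_eval_superset:
  assumes "finite S" "Poly_Mapping.keys P \<subseteq> S" and [simp]: "\<And>v. f v \<in> carrier R"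
  shows "poly_eval R f P = (\<Oplus>m\<in>S. [Poly_Mapping.lookup P m] \<cdot>
    (\<Otimes>v \<in> Poly_Mapping.keys m. f v [^] Poly_Mapping.lookup m v))"
  unfolding poly_eval_def using assms(1,2)
  by (intro add.finprod_mono_neutral_cong_left) (auto simp: in_keys_iff int_pow_0_add intro!: add.int_pow_closed)

lemma poly_eval_add:
  assumes [simp]: "\<And>v. f v \<in> carrier R"
  shows "poly_eval R f (P + Q) = poly_eval R f P \<oplus> poly_eval R f Q"
proof -
  let ?S = "Poly_Mapping.keys P \<union> Poly_Mapping.keys Q"
  have "Poly_Mapping.keys (P + Q) \<subseteq> ?S" by (rule Poly_Mapping.keys_add)
  then show ?thesis
    by (simp add: poly_eval_superset[of ?S] lookup_add add.int_pow_mult add.finprod_multf add.int_pow_closed Pi_def)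
qed

lemma poly_eval_single:
  assumes [simp]: "\<And>v. f v \<in> carrier R"
  shows "poly_eval R f (Poly_Mapping.single m c) =
    [c] \<cdot> (\<Otimes>v \<in> Poly_Mapping.keys m. f v [^] Poly_Mapping.lookup m v)"
  by (subst poly_eval_superset[of "{m}"]) (auto intro!: add.int_pow_closed)

lemma eval_power_prod_superset:
  fixes m :: "'v \<Rightarrow>\<^sub>0 nat"
  assumes "finite S" "Poly_Mapping.keys m \<subseteq> S" and [simp]: "\<And>v. f v \<in> carrier R"
  shows "(\<Otimes>v \<in> Poly_Mapping.keys m. f v [^] Poly_Mapping.lookup m v) = (\<Otimes>v\<in>S. f v [^] Poly_Mapping.lookup m v)"
  using assms(1,2) by (intro finprod_mono_neutral_cong_left) (auto simp: in_keys_iff)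

lemma eval_power_prod_add:
  fixes m m' :: "'v \<Rightarrow>\<^sub>0 nat"
  assumes [simp]: "\<And>v. f v \<in> carrier R"
  shows "(\<Otimes>v \<in> Poly_Mapping.keys (m + m'). f v [^] Poly_Mapping.lookup (m + m') v) =
    (\<Otimes>v \<in> Poly_Mapping.keys m. f v [^] Poly_Mapping.lookup m v) \<otimes>
    (\<Otimes>v \<in> Poly_Mapping.keys m'. f v [^] Poly_Mapping.lookup m' v)"
proof -
  let ?S = "Poly_Mapping.keys m \<union> Poly_Mapping.keys m'"
  have sub: "Poly_Mapping.keys (m + m') \<subseteq> ?S" by (rule Poly_Mapping.keys_add)
  have fin: "finite ?S" by simp
  show ?thesis
    unfolding eval_power_prod_superset[OF fin sub assms] eval_power_prod_superset[OF fin Un_upper1 assms]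
      eval_power_prod_superset[OF fin Un_upper2 assms]
    by (simp add: lookup_add nat_pow_mult[symmetric] Pi_def)
qed

lemma eval_power_prod_single:
  fixes k :: nat
  assumes [simp]: "\<And>v. f v \<in> carrier R"
  shows "(\<Otimes>u \<in> Poly_Mapping.keys (Poly_Mapping.single v k).
    f u [^] Poly_Mapping.lookup (Poly_Mapping.single v k) u) = f v [^] k"
  by (subst eval_power_prod_superset[of "{v}"]) auto

end


section \<open>Plethysms of elementary symmetric functions\<close>

lemma elem_sym_0: "finite I \<Longrightarrow> elem_sym I f 0 = 1"
proof -
  assume "finite I"
  then have "{A. A \<subseteq> I \<and> card A = 0} = {{}}" by (auto dest: finite_subset)
  then show ?thesis by (simp add: elem_sym_def)
qed

lemma elem_sym_empty_Suc:
  fixes f :: "'i \<Rightarrow> 'c::comm_ring_1"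
  shows "elem_sym {} f (Suc k) = 0"
proof -
  have "{A. A \<subseteq> {} \<and> card A = Suc k} = ({} :: 'i set set)" by auto
  then show ?thesis unfolding elem_sym_def by (simp only: sum.empty)
qed

text \<open>The subsets of \<open>insert i I\<close> are split by whether they contain
  \<open>i\<close>. This recursion reduces identities between elementary symmetric functions to
  induction on the set of variables.\<close>

lemma elem_sym_insert:
  assumes "finite I" "i \<notin> I"
  shows "elem_sym (insert i I) f (Suc k) = elem_sym I f (Suc k) + f i * elem_sym I f k"
proof -
  let ?B = "{A. A \<subseteq> I \<and> card A = Suc k}" and ?C = "{A. A \<subseteq> I \<and> card A = k}"
  have fin: "finite ?B" "finite ?C" using assms by auto
  have eq: "{A. A \<subseteq> insert i I \<and> card A = Suc k} = ?B \<union> insert i ` ?C"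
  proof (intro equalityI subsetI)
    fix A assume A: "A \<in> {A. A \<subseteq> insert i I \<and> card A = Suc k}"
    show "A \<in> ?B \<union> insert i ` ?C"
    proof (cases "i \<in> A")
      case True
      then have "A - {i} \<in> ?C" "A = insert i (A - {i})" using A by auto
      then show ?thesis by blast
    qed (use A in auto)
  next
    fix A assume "A \<in> ?B \<union> insert i ` ?C"
    then show "A \<in> {A. A \<subseteq> insert i I \<and> card A = Suc k}"
      using assms by (auto simp: card_insert_if finite_subset)
  qed
  have inj: "inj_on (insert i) ?C" using assms by (auto simp: inj_on_def)
  have "elem_sym (insert i I) f (Suc k) = (\<Sum>A\<in>?B. prod f A) + (\<Sum>A\<in>insert i ` ?C. prod f A)"
    unfolding elem_sym_def eq using assms fin by (intro sum.union_disjoint) auto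
  also have "(\<Sum>A\<in>insert i ` ?C. prod f A) = (\<Sum>A\<in>?C. f i * prod f A)"
    unfolding sum.reindex[OF inj] o_def using assms
    by (intro sum.cong refl prod.insert) (auto dest: finite_subset)
  finally show ?thesis by (simp add: elem_sym_def sum_distrib_left)
qed

text \<open>Up to sign these are the coefficients of \<open>t^4\<close> and \<open>t^6\<close> in
  the identity between the product of all \<open>(1 + x t) (1 - x t)\<close> and the product of all
  \<open>1 - x^2 t^2\<close>.\<close>

lemma elem_sym_squares:
  fixes f :: "'i \<Rightarrow> 'c::comm_ring_1"
  assumes "finite I"
  defines "e \<equiv> elem_sym I f" and "s \<equiv> elem_sym I (\<lambda>i. f i ^ 2)"
  shows "s 2 = e 2 ^ 2 - 2 * e 1 * e 3 + 2 * e 4"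
    and "s 3 = e 3 ^ 2 - 2 * e 2 * e 4 + 2 * e 1 * e 5 - 2 * e 6"
proof -
  \<comment> \<open>Adding a variable \<open>x\<close> turns \<open>s (k + 1)\<close> into
    \<open>s (k + 1) + x^2 * s k\<close>, so the induction has to carry the formula for
    \<open>s 1\<close> as well.\<close>
  have "s 1 = e 1 ^ 2 - 2 * e 2 \<and> s 2 = e 2 ^ 2 - 2 * e 1 * e 3 + 2 * e 4 \<and>
    s 3 = e 3 ^ 2 - 2 * e 2 * e 4 + 2 * e 1 * e 5 - 2 * e 6"
    unfolding e_def s_def using assms(1)
  proof (induction I rule: finite_induct)
    case empty
    show ?case by (simp add: numeral_eq_Suc elem_sym_empty_Suc)
  next
    case (insert i I)
    define e s where "e = elem_sym I f" and "s = elem_sym I (\<lambda>i. f i ^ 2)"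
    have IH: "s 1 = e 1 ^ 2 - 2 * e 2" "s 2 = e 2 ^ 2 - 2 * e 1 * e 3 + 2 * e 4"
      "s 3 = e 3 ^ 2 - 2 * e 2 * e 4 + 2 * e 1 * e 5 - 2 * e 6"
      using insert.IH unfolding e_def s_def by auto
    have ins: "elem_sym (insert i I) g 1 = elem_sym I g 1 + g i"
      "elem_sym (insert i I) g 2 = elem_sym I g 2 + g i * elem_sym I g 1"
      "elem_sym (insert i I) g 3 = elem_sym I g 3 + g i * elem_sym I g 2"
      "elem_sym (insert i I) g 4 = elem_sym I g 4 + g i * elem_sym I g 3"
      "elem_sym (insert i I) g 5 = elem_sym I g 5 + g i * elem_sym I g 4"
      "elem_sym (insert i I) g 6 = elem_sym I g 6 + g i * elem_sym I g 5" for g :: "'i \<Rightarrow> 'c"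
      using elem_sym_insert[OF insert.hyps(1,2), of g] elem_sym_0[OF insert.hyps(1), of g]
      by (simp_all add: numeral_eq_Suc)
    show ?case
      unfolding ins unfolding e_def[symmetric] s_def[symmetric] IH
      by (simp add: algebra_simps power2_eq_square power3_eq_cube)
  qed
  then show "s 2 = e 2 ^ 2 - 2 * e 1 * e 3 + 2 * e 4"
    "s 3 = e 3 ^ 2 - 2 * e 2 * e 4 + 2 * e 1 * e 5 - 2 * e 6" by auto
qed

text \<open>With \<open>w\<close> a primitive cube root of unity,
  \<open>(1 + x t) (1 + w x t) (1 + w^2 x t) = 1 + x^3 t^3\<close>; the formula compares the
  coefficients of \<open>t^6\<close> in the product over all \<open>x\<close>. The induction avoids
  adjoining \<open>w\<close>.\<close>

lemma elem_sym_cubes: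
  fixes f :: "'i \<Rightarrow> 'c::comm_ring_1"
  assumes "finite I"
  defines "e \<equiv> elem_sym I f" and "s \<equiv> elem_sym I (\<lambda>i. f i ^ 3)"
  shows "s 2 = e 2 ^ 3 - 3 * e 1 * e 2 * e 3 + 3 * e 3 ^ 2 + 3 * e 1 ^ 2 * e 4
      - 3 * e 2 * e 4 - 3 * e 1 * e 5 + 3 * e 6"
proof -
  have "s 1 = e 1 ^ 3 - 3 * e 1 * e 2 + 3 * e 3 \<and>
    s 2 = e 2 ^ 3 - 3 * e 1 * e 2 * e 3 + 3 * e 3 ^ 2 + 3 * e 1 ^ 2 * e 4
      - 3 * e 2 * e 4 - 3 * e 1 * e 5 + 3 * e 6"
    unfolding e_def s_def using assms(1)
  proof (induction I rule: finite_induct)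
    case empty
    show ?case by (simp add: numeral_eq_Suc elem_sym_empty_Suc)
  next
    case (insert i I)
    define e s where "e = elem_sym I f" and "s = elem_sym I (\<lambda>i. f i ^ 3)"
    have IH: "s 1 = e 1 ^ 3 - 3 * e 1 * e 2 + 3 * e 3"
      "s 2 = e 2 ^ 3 - 3 * e 1 * e 2 * e 3 + 3 * e 3 ^ 2 + 3 * e 1 ^ 2 * e 4
      - 3 * e 2 * e 4 - 3 * e 1 * e 5 + 3 * e 6"
      using insert.IH unfolding e_def s_def by auto
    have ins: "elem_sym (insert i I) g 1 = elem_sym I g 1 + g i"
      "elem_sym (insert i I) g 2 = elem_sym I g 2 + g i * elem_sym I g 1"
      "elem_sym (insert i I) g 3 = elem_sym I g 3 + g i * elem_sym I g 2"
      "elem_sym (insert i I) g 4 = elem_sym I g 4 + g i * elem_sym I g 3"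
      "elem_sym (insert i I) g 5 = elem_sym I g 5 + g i * elem_sym I g 4"
      "elem_sym (insert i I) g 6 = elem_sym I g 6 + g i * elem_sym I g 5" for g :: "'i \<Rightarrow> 'c"
      using elem_sym_insert[OF insert.hyps(1,2), of g] elem_sym_0[OF insert.hyps(1), of g]
      by (simp_all add: numeral_eq_Suc)
    show ?case
      unfolding ins unfolding e_def[symmetric] s_def[symmetric] IH
      by (simp add: algebra_simps power2_eq_square power3_eq_cube)
  qed
  then show "s 2 = e 2 ^ 3 - 3 * e 1 * e 2 * e 3 + 3 * e 3 ^ 2 + 3 * e 1 ^ 2 * e 4
      - 3 * e 2 * e 4 - 3 * e 1 * e 5 + 3 * e 6" by auto
qed

text \<open>Newton's identities with denominators cleared, hence valid in every commutative ring.
  Power sums suit plethysms because a power of a squarefree monomial is the same monomial in the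
  powers of the variables.\<close>

lemma newton_coeff_prod_linear:
  fixes c :: "'i \<Rightarrow> 'c::comm_ring_1"
  assumes "finite S"
  defines "p \<equiv> (\<Prod>i\<in>S. [:1, c i:])"
  shows "2 * poly.coeff p 2 = (\<Sum>i\<in>S. c i) ^ 2 - (\<Sum>i\<in>S. c i ^ 2)"
    and "6 * poly.coeff p 3 = (\<Sum>i\<in>S. c i) ^ 3 - 3 * (\<Sum>i\<in>S. c i) * (\<Sum>i\<in>S. c i ^ 2) + 2 * (\<Sum>i\<in>S. c i ^ 3)"
proof -
  have "poly.coeff p 0 = 1 \<and> poly.coeff p 1 = (\<Sum>i\<in>S. c i) \<and>
    2 * poly.coeff p 2 = (\<Sum>i\<in>S. c i) ^ 2 - (\<Sum>i\<in>S. c i ^ 2) \<and>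
    6 * poly.coeff p 3 = (\<Sum>i\<in>S. c i) ^ 3 - 3 * (\<Sum>i\<in>S. c i) * (\<Sum>i\<in>S. c i ^ 2) + 2 * (\<Sum>i\<in>S. c i ^ 3)"
    unfolding p_def using assms(1)
  proof (induction S rule: finite_induct)
    case empty
    show ?case by simp
  next
    case (insert i S)
    define q s1 s2 s3 where "q = (\<Prod>i\<in>S. [:1, c i:])" and "s1 = (\<Sum>i\<in>S. c i)"
      and "s2 = (\<Sum>i\<in>S. c i ^ 2)" and "s3 = (\<Sum>i\<in>S. c i ^ 3)"
    have IH: "poly.coeff q 0 = 1" "poly.coeff q 1 = s1" "2 * poly.coeff q 2 = s1 ^ 2 - s2"
      "6 * poly.coeff q 3 = s1 ^ 3 - 3 * s1 * s2 + 2 * s3"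
      using insert.IH unfolding q_def s1_def s2_def s3_def by auto
    have co: "poly.coeff ([:1, c i:] * q) 0 = poly.coeff q 0"
      "poly.coeff ([:1, c i:] * q) 1 = poly.coeff q 1 + c i * poly.coeff q 0"
      "poly.coeff ([:1, c i:] * q) 2 = poly.coeff q 2 + c i * poly.coeff q 1"
      "poly.coeff ([:1, c i:] * q) 3 = poly.coeff q 3 + c i * poly.coeff q 2"
      by (simp_all add: numeral_eq_Suc)
    \<comment> \<open>Regrouping exposes the multiples \<open>2 * poly.coeff q 2\<close> and
      \<open>6 * poly.coeff q 3\<close>, the only forms in which the induction hypothesis knows
      these coefficients.\<close>
    have "2 * (poly.coeff q 2 + c i * poly.coeff q 1) = 2 * poly.coeff q 2 + 2 * c i * poly.coeff q 1"
      and "6 * (poly.coeff q 3 + c i * poly.coeff q 2) = 6 * poly.coeff q 3 + 3 * c i * (2 * poly.coeff q 2)"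
      by (simp_all add: algebra_simps)
    then show ?case
      unfolding prod.insert[OF insert.hyps] sum.insert[OF insert.hyps]
      unfolding q_def[symmetric] s1_def[symmetric] s2_def[symmetric] s3_def[symmetric] co
      by (simp only: IH) (simp add: algebra_simps power2_eq_square power3_eq_cube)
  qed
  then show "2 * poly.coeff p 2 = (\<Sum>i\<in>S. c i) ^ 2 - (\<Sum>i\<in>S. c i ^ 2)"
    "6 * poly.coeff p 3 = (\<Sum>i\<in>S. c i) ^ 3 - 3 * (\<Sum>i\<in>S. c i) * (\<Sum>i\<in>S. c i ^ 2) + 2 * (\<Sum>i\<in>S. c i ^ 3)"
    by auto
qed

text \<open>Removes the factors 2 and 6 that Newton's identities introduce; coefficient by
  coefficient this is cancellation in the integers.\<close>

lemma int_poly_mult_of_nat_cancel: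
  fixes P Q :: "'v int_poly"
  assumes "of_nat k * P = of_nat k * Q" "k > 0"
  shows "P = Q"
proof (rule poly_mapping_eqI)
  fix m
  have *: "Poly_Mapping.lookup (of_nat k * X) m = int k * Poly_Mapping.lookup X m" for X :: "'v int_poly"
    by (induction k) (simp_all add: distrib_right lookup_add)
  show "Poly_Mapping.lookup P m = Poly_Mapping.lookup Q m"
    using arg_cong[OF assms(1), of "\<lambda>X. Poly_Mapping.lookup X m"] assms(2) by (simp add: *)
qed

text \<open>Since \<open>2 e\<^sub>2 = p\<^sub>1\<^sup>2 - p\<^sub>2\<close> and \<open>6 e\<^sub>3 = p\<^sub>1\<^sup>3 - 3 p\<^sub>1 p\<^sub>2 + 2 p\<^sub>3\<close>, the plethysms \<open>e\<^sub>2[e\<^sub>3]\<close> and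
  \<open>e\<^sub>3[e\<^sub>2]\<close> come down to the elementary symmetric functions of the squares and cubes of the variables:
  \<open>e\<^sub>2[e\<^sub>3] = e\<^sub>2 e\<^sub>4 - e\<^sub>1 e\<^sub>5 + e\<^sub>6\<close> and
  \<open>e\<^sub>3[e\<^sub>2] = e\<^sub>3\<^sup>2 + e\<^sub>1\<^sup>2 e\<^sub>4 - 2 e\<^sub>2 e\<^sub>4 - e\<^sub>1 e\<^sub>5 + e\<^sub>6\<close>.\<close>

definition comp_poly_2_3 :: "nat int_poly" where
  "comp_poly_2_3 =
     Poly_Mapping.single (Poly_Mapping.single 2 1 + Poly_Mapping.single 4 1) 1
   + Poly_Mapping.single (Poly_Mapping.single 1 1 + Poly_Mapping.single 5 1) (- 1)
   + Poly_Mapping.single (Poly_Mapping.single 6 1) 1"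

definition comp_poly_3_2 :: "nat int_poly" where
  "comp_poly_3_2 =
     Poly_Mapping.single (Poly_Mapping.single 3 2) 1
   + Poly_Mapping.single (Poly_Mapping.single 1 2 + Poly_Mapping.single 4 1) 1
   + Poly_Mapping.single (Poly_Mapping.single 2 1 + Poly_Mapping.single 4 1) (- 2)
   + Poly_Mapping.single (Poly_Mapping.single 1 1 + Poly_Mapping.single 5 1) (- 1)
   + Poly_Mapping.single (Poly_Mapping.single 6 1) 1"

lemma poly_vars_add: "poly_vars (P + Q) \<subseteq> poly_vars P \<union> poly_vars Q"
  unfolding poly_vars_def using Poly_Mapping.keys_add[of P Q] by blast

lemma poly_vars_single: "poly_vars (Poly_Mapping.single m c) \<subseteq> Poly_Mapping.keys m"
  unfolding poly_vars_def by auto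

lemma is_comp_poly_2_3: "is_comp_poly 2 3 comp_poly_2_3"
  unfolding is_comp_poly_def
proof
  let ?I = "{1..2 * 3::nat}" and ?x = "poly_var :: nat \<Rightarrow> nat int_poly"
  show "poly_vars comp_poly_2_3 \<subseteq> ?I"
    unfolding comp_poly_2_3_def
    by (intro order_trans[OF poly_vars_add] Un_least order_trans[OF poly_vars_single]
        order_trans[OF Poly_Mapping.keys_add]) auto
  let ?S = "{A. A \<subseteq> ?I \<and> card A = 3}"
  let ?p = "\<Prod>A\<in>?S. [:1, \<Prod>i\<in>A. ?x i:]"
  let ?e = "elem_sym ?I ?x"
  have fin: "finite ?S" by simp
  have p1: "(\<Sum>A\<in>?S. \<Prod>i\<in>A. ?x i) = ?e 3" by (simp add: elem_sym_def)
  have p2: "(\<Sum>A\<in>?S. (\<Prod>i\<in>A. ?x i) ^ 2) = elem_sym ?I (\<lambda>i. ?x i ^ 2) 3"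
    by (simp add: elem_sym_def prod_power_distrib)
  have sq: "elem_sym ?I (\<lambda>i. ?x i ^ 2) 3 = ?e 3 ^ 2 - 2 * ?e 2 * ?e 4 + 2 * ?e 1 * ?e 5 - 2 * ?e 6"
    by (rule elem_sym_squares) simp
  have "2 * poly.coeff ?p 2 = 2 * (?e 2 * ?e 4 - ?e 1 * ?e 5 + ?e 6)"
    unfolding newton_coeff_prod_linear(1)[OF fin] p1 p2 sq by (simp add: algebra_simps)
  then have "poly.coeff ?p 2 = ?e 2 * ?e 4 - ?e 1 * ?e 5 + ?e 6"
    using int_poly_mult_of_nat_cancel[of 2, simplified] by blast
  then show "poly_subst ?e comp_poly_2_3 = poly.coeff ?p 2"
    unfolding comp_poly_2_3_def
    by (simp add: poly_subst_add poly_subst_single power_prod_add power_prod_single)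
qed

lemma is_comp_poly_3_2: "is_comp_poly 3 2 comp_poly_3_2"
  unfolding is_comp_poly_def
proof
  let ?I = "{1..3 * 2::nat}" and ?x = "poly_var :: nat \<Rightarrow> nat int_poly"
  show "poly_vars comp_poly_3_2 \<subseteq> ?I"
    unfolding comp_poly_3_2_def
    by (intro order_trans[OF poly_vars_add] Un_least order_trans[OF poly_vars_single]
        order_trans[OF Poly_Mapping.keys_add]) auto
  let ?S = "{A. A \<subseteq> ?I \<and> card A = 2}"
  let ?p = "\<Prod>A\<in>?S. [:1, \<Prod>i\<in>A. ?x i:]"
  let ?e = "elem_sym ?I ?x"
  have fin: "finite ?S" by simp
  have p1: "(\<Sum>A\<in>?S. \<Prod>i\<in>A. ?x i) = ?e 2" by (simp add: elem_sym_def)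
  have p2: "(\<Sum>A\<in>?S. (\<Prod>i\<in>A. ?x i) ^ 2) = elem_sym ?I (\<lambda>i. ?x i ^ 2) 2"
    by (simp add: elem_sym_def prod_power_distrib)
  have p3: "(\<Sum>A\<in>?S. (\<Prod>i\<in>A. ?x i) ^ 3) = elem_sym ?I (\<lambda>i. ?x i ^ 3) 2"
    by (simp add: elem_sym_def prod_power_distrib)
  have sq: "elem_sym ?I (\<lambda>i. ?x i ^ 2) 2 = ?e 2 ^ 2 - 2 * ?e 1 * ?e 3 + 2 * ?e 4"
    by (rule elem_sym_squares) simp
  have cu: "elem_sym ?I (\<lambda>i. ?x i ^ 3) 2 = ?e 2 ^ 3 - 3 * ?e 1 * ?e 2 * ?e 3 + 3 * ?e 3 ^ 2
      + 3 * ?e 1 ^ 2 * ?e 4 - 3 * ?e 2 * ?e 4 - 3 * ?e 1 * ?e 5 + 3 * ?e 6"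
    by (rule elem_sym_cubes) simp
  have "6 * poly.coeff ?p 3 = 6 * (?e 3 ^ 2 + ?e 1 ^ 2 * ?e 4 - 2 * (?e 2 * ?e 4) - ?e 1 * ?e 5 + ?e 6)"
    unfolding newton_coeff_prod_linear(2)[OF fin] p1 p2 p3 sq cu
    by (simp add: algebra_simps power2_eq_square power3_eq_cube)
  then have "poly.coeff ?p 3 = ?e 3 ^ 2 + ?e 1 ^ 2 * ?e 4 - 2 * (?e 2 * ?e 4) - ?e 1 * ?e 5 + ?e 6"
    using int_poly_mult_of_nat_cancel[of 6, simplified] by blast
  then show "poly_subst ?e comp_poly_3_2 = poly.coeff ?p 3"
    unfolding comp_poly_3_2_def
    by (simp add: poly_subst_add poly_subst_single power_prod_add power_prod_single)
qed

section \<open>The two plethysms in an arbitrary lambda-ring\<close>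

lemma (in lambda_ring) lam_2_lam_3:
  assumes r: "r \<in> carrier R"
  shows "lam R 2 (lam R 3 r) = lam R 2 r \<otimes> lam R 4 r \<oplus> [(- 1::int)] \<cdot> (r \<otimes> lam R 5 r) \<oplus> lam R 6 r"
proof -
  have [simp]: "lam R i r \<in> carrier R" for i using lam_closed r .
  show ?thesis
    unfolding lam_lam[OF r is_comp_poly_2_3] comp_poly_2_3_def using r lam_1[OF r]
    by (simp add: poly_eval_add poly_eval_single eval_power_prod_add eval_power_prod_single add.int_pow_1)
qed

lemma (in lambda_ring) lam_3_lam_2:
  assumes r: "r \<in> carrier R"
  shows "lam R 3 (lam R 2 r) = lam R 3 r \<otimes> lam R 3 r \<oplus> (r \<otimes> r) \<otimes> lam R 4 r
    \<oplus> [(- 2::int)] \<cdot> (lam R 2 r \<otimes> lam R 4 r) \<oplus> [(- 1::int)] \<cdot> (r \<otimes> lam R 5 r) \<oplus> lam R 6 r"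
proof -
  have [simp]: "lam R i r \<in> carrier R" for i using lam_closed r .
  have sq: "x [^] (2::nat) = x \<otimes> x" if "x \<in> carrier R" for x
    using that by (simp add: numeral_eq_Suc)
  show ?thesis
    unfolding lam_lam[OF r is_comp_poly_3_2] comp_poly_3_2_def using r lam_1[OF r]
    by (simp add: poly_eval_add poly_eval_single eval_power_prod_add eval_power_prod_single sq add.int_pow_1)
qed


section \<open>Powers of two dividing \<open>3\<^sup>n - 1\<close>\<close>

lemma nine_power_mod_16: "(9::int) ^ m mod 16 = (if even m then 1 else 9)"
proof (induction m)
  case (Suc m)
  have "(9::int) ^ Suc m mod 16 = 9 * (9 ^ m mod 16) mod 16" by (simp add: mod_mult_right_eq)
  then show ?case using Suc by simp
qed simp

lemma three_power_even_mod_4: "even n \<Longrightarrow> (3::int) ^ n mod 4 = 1"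
proof -
  assume "even n"
  then obtain m where m: "n = 2 * m" ..
  have "(3::int) ^ n = 9 ^ m" by (simp add: m power_mult)
  moreover have "(9::int) ^ m mod 4 = (9 mod 4) ^ m mod 4" by (rule power_mod[symmetric])
  ultimately show ?thesis by simp
qed

text \<open>For exponent \<open>2 * m\<close> with \<open>m\<close> odd, \<open>9 ^ m\<close> is 9
  modulo 16. Each doubling of the exponent multiplies \<open>x - 1\<close> by \<open>x + 1\<close>,
  where \<open>x\<close> is an even power of 3; then \<open>x + 1\<close> is 2 modulo 4 and adds
  exactly one factor 2.\<close>

lemma not_pow2_dvd_three_power_minus_1:
  assumes "odd m"
  shows "\<not> (2::int) ^ (k + 4) dvd 3 ^ (2 ^ Suc k * m) - 1"
proof (induction k)
  case 0
  have eq: "(3::int) ^ (2 * m) = 9 ^ m" by (simp add: power_mult)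
  have "(9::int) ^ m mod 16 = 9" using assms by (simp add: nine_power_mod_16)
  then have "\<not> (16::int) dvd 9 ^ m - 1" by presburger
  then show ?case using eq by simp
next
  case (Suc k)
  let ?n = "2 ^ Suc k * m"
  have eq: "(3::int) ^ (2 ^ Suc (Suc k) * m) - 1 = (3 ^ ?n - 1) * (3 ^ ?n + 1)"
  proof -
    have "(3::int) ^ (2 ^ Suc (Suc k) * m) = (3 ^ ?n) ^ 2" by (simp flip: power_mult)
    then show ?thesis by (simp only: power2_eq_square square_diff_one_factored mult.commute)
  qed
  have "(3::int) ^ ?n mod 4 = 1" by (rule three_power_even_mod_4) simp
  then have "(3 ^ ?n + 1 :: int) mod 4 = 2" by presburger
  then obtain u where u: "(3 ^ ?n + 1 :: int) = 2 * u" and "odd u"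
    by (intro that[of "(3 ^ ?n + 1) div 2"]) presburger+
  show ?case
  proof
    assume "(2::int) ^ (Suc k + 4) dvd 3 ^ (2 ^ Suc (Suc k) * m) - 1"
    then have "2 * 2 ^ (k + 4) dvd 2 * ((3 ^ ?n - 1) * u)"
      unfolding eq u by (simp only: add_Suc power_Suc mult.left_commute)
    then have "2 ^ (k + 4) dvd (3 ^ ?n - 1) * u" by (simp only: dvd_mult_cancel_left) simp
    moreover have "coprime (2 ^ (k + 4)) u" using \<open>odd u\<close> by simp
    ultimately show False using Suc by (simp add: coprime_dvd_mult_left_iff)
  qed
qed

text \<open>For odd \<open>n\<close> the number \<open>3 ^ n - 1\<close> is 2 modulo 4, which leaves
  only \<open>n = 1\<close>. For \<open>n = 2 ^ Suc k * m\<close> with \<open>m\<close> odd, the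
  preceding bound forces \<open>n < k + 4\<close>, hence \<open>k \<le> 1\<close> and
  \<open>m = 1\<close>.\<close>

lemma pow2_dvd_three_power_minus_1:
  fixes n :: nat
  assumes "n \<ge> 1" and dvd: "(2::int) ^ n dvd 3 ^ n - 1"
  shows "n = 1 \<or> n = 2 \<or> n = 4"
proof (cases "even n")
  case False
  then obtain m where m: "n = Suc (2 * m)" by (auto elim: oddE)
  have "(3::int) ^ (2 * m) mod 4 = 1" by (rule three_power_even_mod_4) simp
  then have "(3 ^ n - 1 :: int) mod 4 = 2" unfolding m power_Suc by presburger
  then have "\<not> (4::int) dvd 3 ^ n - 1" by presburger
  then have "\<not> (2::int) ^ 2 dvd 3 ^ n - 1" by simp
  then have "\<not> 2 \<le> n" using dvd power_le_dvd by blast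
  then show ?thesis using assms(1) by simp
next
  case True
  obtain j m where j: "n = 2 ^ j * m" "odd m"
    by (rule multiplicity_decompose'[of n "2::nat"]) (use assms(1) in auto)
  then obtain k where k: "j = Suc k" using True by (cases j) auto
  have "\<not> (2::int) ^ (k + 4) dvd 3 ^ n - 1"
    using not_pow2_dvd_three_power_minus_1[OF j(2)] j(1) k by simp
  then have "\<not> k + 4 \<le> n" using dvd power_le_dvd by blast
  then have le: "2 ^ Suc k * m < k + 4" using j k by simp
  have "m \<ge> 1" using j(2) by (cases m) auto
  then have "2 ^ Suc k \<le> 2 ^ Suc k * m" by simp
  with le have "2 ^ Suc k < k + 4" by (rule le_less_trans[rotated])
  then have "2 * 2 ^ k < k + 4" by simp
  moreover have "k + 4 \<le> 2 * 2 ^ k" if "k \<ge> 2"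
    using that by (induction k rule: dec_induct) auto
  ultimately have "k = 0 \<or> k = 1" by linarith
  then show ?thesis
  proof
    assume "k = 0"
    then have "m < 2" using le by simp
    then show ?thesis using j k \<open>k = 0\<close> \<open>m \<ge> 1\<close> by auto
  next
    assume "k = 1"
    then have "m < 2" using le by simp
    then show ?thesis using j k \<open>k = 1\<close> \<open>m \<ge> 1\<close> by auto
  qed
qed


section \<open>Extensions of the K-theory of spheres\<close>

text \<open>The scalar by which the \<open>k\<close>-th lambda operation acts on the generator of
  the reduced K-group of the \<open>2n\<close>-sphere. It occurs with \<open>n\<close> for the
  \<beta>-coordinate and with \<open>n'\<close> for multiples of \<alpha>.\<close>

definition sphere_coeff :: "nat \<Rightarrow> nat \<Rightarrow> int" where
  "sphere_coeff n k = (-1) ^ (k - 1) * int k ^ (n - 1)"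

lemma K_sphere_simps:
  "carrier (K_sphere n) = UNIV" "\<zero>\<^bsub>K_sphere n\<^esub> = (0, 0)" "\<one>\<^bsub>K_sphere n\<^esub> = (1, 0)"
  "(p, q) \<oplus>\<^bsub>K_sphere n\<^esub> (p', q') = (p + p', q + q')"
  "(p, q) \<otimes>\<^bsub>K_sphere n\<^esub> (p', q') = (p * p', p * q' + q * p')"
  by (simp_all add: K_sphere_def)

lemma K_sphere_red_simps:
  "carrier (K_sphere_red n) = UNIV" "\<zero>\<^bsub>K_sphere_red n\<^esub> = 0"
  "x \<oplus>\<^bsub>K_sphere_red n\<^esub> y = x + y" "(p, q) \<odot>\<^bsub>K_sphere_red n\<^esub> x = p * x"
  "Lam (K_sphere_red n) k x = sphere_coeff n k * x"
  by (simp_all add: K_sphere_red_def sphere_coeff_def)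

lemma K_sphere_lam_multiple_y:
  assumes "k \<ge> 1"
  shows "lam (K_sphere n) k (0, q) = (0, q * sphere_coeff n k)"
  using K_sphere_lam_y[OF assms, of n] by (simp add: K_sphere_def sphere_coeff_def)

lemma (in lambda_ring) lam_2_add:
  assumes [simp]: "x \<in> carrier R" "y \<in> carrier R"
  shows "lam R 2 (x \<oplus> y) = lam R 2 x \<oplus> x \<otimes> y \<oplus> lam R 2 y"
proof -
  have [simp]: "lam R k x \<in> carrier R" "lam R k y \<in> carrier R" for k by (simp_all add: lam_closed)
  have set: "{0..2::nat} = {0, 1, 2}" by auto
  show ?thesis
    unfolding lam_add[OF assms] set
    by (simp add: lam_0 lam_1[simplified] a_ac)
qed

lemma (in lambda_ring) lam_3_add:
  assumes [simp]: "x \<in> carrier R" "y \<in> carrier R"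
  shows "lam R 3 (x \<oplus> y) = lam R 3 x \<oplus> lam R 2 x \<otimes> y \<oplus> x \<otimes> lam R 2 y \<oplus> lam R 3 y"
proof -
  have [simp]: "lam R k x \<in> carrier R" "lam R k y \<in> carrier R" for k by (simp_all add: lam_closed)
  have set: "{0..3::nat} = {0, 1, 2, 3}" by auto
  show ?thesis
    unfolding lam_add[OF assms] set
    by (simp add: lam_0 lam_1[simplified] a_ac)
qed

section \<open>Ring structure of an extension\<close>

locale sphere_extension = lambda_extension "K_sphere n" "K_sphere_red n'" E a b
  for n n' :: nat and E :: "'e lambda_ring" and a b
begin

lemma a_closed [simp]: "a r \<in> carrier E"
  using a_hom by (auto simp: hom_def K_sphere_red_simps)

lemma a_add: "a (r + r') = a r \<oplus>\<^bsub>E\<^esub> a r'"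
  using a_hom by (auto simp: hom_def K_sphere_red_simps)

lemma a_0: "a 0 = \<zero>\<^bsub>E\<^esub>"
  using a_add[of 0 0] by (metis E.add.r_cancel_one' a_closed add_0)

lemma a_int_multiple: "[(k::int)] \<cdot>\<^bsub>E\<^esub> a r = a (k * r)"
proof (induction k rule: int_induct[of _ 0])
  case base
  show ?case by (simp add: E.int_pow_0_add a_0)
next
  case (step1 k)
  then show ?case by (simp add: E.add.int_pow_mult distrib_right a_add E.add.int_pow_1)
next
  case (step2 k)
  \<comment> \<open>In the downward step \<open>a r\<close> is added back to both sides and then
    cancelled.\<close>
  have "[(k - 1)] \<cdot>\<^bsub>E\<^esub> a r \<oplus>\<^bsub>E\<^esub> a r = [(k - 1 + 1)] \<cdot>\<^bsub>E\<^esub> a r"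
    by (simp only: E.add.int_pow_mult[OF a_closed] E.add.int_pow_1[OF a_closed])
  also have "\<dots> = a ((k - 1) * r + r)" using step2 by (simp add: algebra_simps)
  finally show ?case by (simp add: a_add E.add.int_pow_closed)
qed

lemma b_lam: "x \<in> carrier E \<Longrightarrow> b (lam E k x) = lam (K_sphere n) k (b x)"
  using b_hom by (simp add: lambda_hom_def)

lemma b_add: "x \<in> carrier E \<Longrightarrow> y \<in> carrier E \<Longrightarrow> b (x \<oplus>\<^bsub>E\<^esub> y) = b x \<oplus>\<^bsub>K_sphere n\<^esub> b y"
  using b_hom by (simp add: lambda_hom_def ring_hom_add)

lemma b_mult: "x \<in> carrier E \<Longrightarrow> y \<in> carrier E \<Longrightarrow> b (x \<otimes>\<^bsub>E\<^esub> y) = b x \<otimes>\<^bsub>K_sphere n\<^esub> b y"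
  using b_hom by (simp add: lambda_hom_def ring_hom_mult)

lemma kernel_b: "x \<in> range a \<longleftrightarrow> x \<in> carrier E \<and> b x = (0, 0)"
  using exact unfolding a_kernel_def' K_sphere_red_simps K_sphere_simps by blast

lemma b_a: "b (a r) = (0, 0)"
  using kernel_b by blast

text \<open>The element \<open>x\<close> acts on the image of \<open>a\<close> through a multiple of
  \<open>y\<close>, and \<open>y\<close> annihilates the module. This covers both
  \<open>\<alpha>\<beta> = 0\<close> and \<open>\<alpha>\<^sup>2 = 0\<close>.\<close>

lemma mult_a_eq_0:
  assumes "x \<in> carrier E" "b x = (0, q)"
  shows "x \<otimes>\<^bsub>E\<^esub> a r = \<zero>\<^bsub>E\<^esub>"
  using a_smult[of x r] assms by (simp add: K_sphere_red_simps a_0)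

lemma square_of_lift:
  assumes "x \<in> carrier E" "b x = (0, 1)"
  obtains h where "x \<otimes>\<^bsub>E\<^esub> x = a h"
proof -
  have "b (x \<otimes>\<^bsub>E\<^esub> x) = (0, 0)" using assms by (simp add: b_mult K_sphere_simps)
  then show ?thesis using that kernel_b[of "x \<otimes>\<^bsub>E\<^esub> x"] assms by auto
qed

end

text \<open>Fixing a lift together with its square makes \<open>h\<close> an explicit integer to
  compute with; \<open>hopf_invariant_eq\<close> identifies it with the Hopf invariant.\<close>

locale sphere_extension_lift = sphere_extension +
  fixes \<beta> :: 'c and h :: int
  assumes lift_closed [simp]: "\<beta> \<in> carrier E" and b_lift: "b \<beta> = (0, 1)"
    and lift_square: "\<beta> \<otimes>\<^bsub>E\<^esub> \<beta> = a h"
begin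

text \<open>Coordinates on the ideal of elements lying over multiples of \<open>y\<close>: they
  exist by \<open>eltE\<close> and are unique by \<open>elt_inject\<close>.\<close>

definition elt :: "int \<Rightarrow> int \<Rightarrow> 'c" where
  "elt q r = [q] \<cdot>\<^bsub>E\<^esub> \<beta> \<oplus>\<^bsub>E\<^esub> a r"

lemma elt_closed [simp]: "elt q r \<in> carrier E"
  by (simp add: elt_def E.add.int_pow_closed)

lemma elt_add: "elt q r \<oplus>\<^bsub>E\<^esub> elt q' r' = elt (q + q') (r + r')"
  by (simp add: elt_def E.add.int_pow_closed E.add.int_pow_mult a_add E.a_ac)

lemma elt_0: "elt 0 r = a r"
  by (simp add: elt_def E.int_pow_0_add)

lemma elt_1_0: "elt 1 0 = \<beta>"
  by (simp add: elt_def a_0 E.add.int_pow_1)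

lemma b_elt: "b (elt q r) = (0, q)"
proof -
  have "b ([q] \<cdot>\<^bsub>E\<^esub> \<beta>) = (0, q)"
  proof (induction q rule: int_induct[of _ 0])
    case base
    show ?case using b_a[of 0] by (simp add: E.int_pow_0_add a_0)
  next
    case (step1 k)
    then show ?case
      by (simp add: E.add.int_pow_mult E.add.int_pow_1 b_add b_lift K_sphere_simps E.add.int_pow_closed)
  next
    case (step2 k)
    have "[(k - 1)] \<cdot>\<^bsub>E\<^esub> \<beta> \<oplus>\<^bsub>E\<^esub> \<beta> = [(k - 1 + 1)] \<cdot>\<^bsub>E\<^esub> \<beta>"
      by (simp only: E.add.int_pow_mult[OF lift_closed] E.add.int_pow_1[OF lift_closed])
    then have "b ([(k - 1)] \<cdot>\<^bsub>E\<^esub> \<beta>) \<oplus>\<^bsub>K_sphere n\<^esub> (0, 1) = (0, k)"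
      using step2 b_add[of "[(k - 1)] \<cdot>\<^bsub>E\<^esub> \<beta>" \<beta>] by (simp add: b_lift E.add.int_pow_closed)
    then show ?case by (cases "b ([(k - 1)] \<cdot>\<^bsub>E\<^esub> \<beta>)") (simp add: K_sphere_simps)
  qed
  then show ?thesis
    by (simp add: elt_def b_add b_a K_sphere_simps E.add.int_pow_closed)
qed

text \<open>All products involving \<alpha> vanish, so only \<open>q q' \<beta>\<^sup>2\<close>
  survives.\<close>

lemma elt_mult: "elt q r \<otimes>\<^bsub>E\<^esub> elt q' r' = a (q * q' * h)"
proof -
  have [simp]: "[k] \<cdot>\<^bsub>E\<^esub> \<beta> \<in> carrier E" for k :: int by (rule E.add.int_pow_closed) simp
  have ann: "x \<otimes>\<^bsub>E\<^esub> a r = \<zero>\<^bsub>E\<^esub>" "a r \<otimes>\<^bsub>E\<^esub> x = \<zero>\<^bsub>E\<^esub>" if "x = elt k l" for x k l r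
    using mult_a_eq_0[OF elt_closed b_elt] that by (simp_all add: E.m_comm)
  have \<beta>: "[k] \<cdot>\<^bsub>E\<^esub> \<beta> = elt k 0" for k by (simp add: elt_def a_0)
  have "elt q r \<otimes>\<^bsub>E\<^esub> elt q' r' = elt q r \<otimes>\<^bsub>E\<^esub> ([q'] \<cdot>\<^bsub>E\<^esub> \<beta>) \<oplus>\<^bsub>E\<^esub> elt q r \<otimes>\<^bsub>E\<^esub> a r'"
    unfolding elt_def[of q' r'] by (simp add: E.r_distr)
  also have "\<dots> = elt q r \<otimes>\<^bsub>E\<^esub> ([q'] \<cdot>\<^bsub>E\<^esub> \<beta>)"
    by (simp add: ann[OF refl])
  also have "\<dots> = ([q] \<cdot>\<^bsub>E\<^esub> \<beta>) \<otimes>\<^bsub>E\<^esub> ([q'] \<cdot>\<^bsub>E\<^esub> \<beta>) \<oplus>\<^bsub>E\<^esub> a r \<otimes>\<^bsub>E\<^esub> ([q'] \<cdot>\<^bsub>E\<^esub> \<beta>)"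
    unfolding elt_def by (simp add: E.l_distr)
  also have "\<dots> = ([q] \<cdot>\<^bsub>E\<^esub> \<beta>) \<otimes>\<^bsub>E\<^esub> ([q'] \<cdot>\<^bsub>E\<^esub> \<beta>)"
    by (simp add: ann(2)[OF \<beta>])
  also have "\<dots> = a (q * q' * h)"
    by (simp add: E.add_pow_ldistr_int E.add_pow_rdistr_int lift_square a_int_multiple mult_ac)
  finally show ?thesis .
qed

lemma elt_inject: "elt q r = elt q' r' \<longleftrightarrow> q = q' \<and> r = r'"
proof
  assume eq: "elt q r = elt q' r'"
  then have q: "q = q'" using b_elt by (metis prod.inject)
  then have "a r = a r'" using eq by (simp add: elt_def E.add.int_pow_closed)
  then show "q = q' \<and> r = r'" using a_inj q by (auto simp: inj_on_def K_sphere_red_simps)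
qed simp

lemma eltE:
  assumes "x \<in> carrier E" "b x = (0, q)"
  obtains r where "x = elt q r"
proof -
  have "b (x \<oplus>\<^bsub>E\<^esub> elt (- q) 0) = (0, 0)" using assms by (simp add: b_add b_elt K_sphere_simps)
  then obtain r where r: "x \<oplus>\<^bsub>E\<^esub> elt (- q) 0 = a r"
    using kernel_b[of "x \<oplus>\<^bsub>E\<^esub> elt (- q) 0"] assms by auto
  have "x = x \<oplus>\<^bsub>E\<^esub> (elt (- q) 0 \<oplus>\<^bsub>E\<^esub> elt q 0)"
    using assms by (simp add: elt_add elt_0 a_0)
  also have "\<dots> = elt 0 r \<oplus>\<^bsub>E\<^esub> elt q 0" using assms r by (simp add: E.a_assoc[symmetric] elt_0)
  finally show ?thesis using that by (simp add: elt_add)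
qed

text \<open>Any other lift is \<open>\<beta> + r \<alpha>\<close> and has the same square, because
  \<alpha> is annihilated. Injectivity of \<open>a\<close> gives the uniqueness that the definite
  description requires.\<close>

lemma hopf_invariant_eq: "hopf_invariant (E, a, b) = h"
  unfolding hopf_invariant_def prod.case
proof (rule the_equality)
  show "\<forall>\<beta>'\<in>carrier E. b \<beta>' = (0, 1) \<longrightarrow> \<beta>' \<otimes>\<^bsub>E\<^esub> \<beta>' = [h] \<cdot>\<^bsub>E\<^esub> a 1"
  proof (intro ballI impI)
    fix \<beta>' assume "\<beta>' \<in> carrier E" "b \<beta>' = (0, 1)"
    then obtain r where "\<beta>' = elt 1 r" by (rule eltE)
    then show "\<beta>' \<otimes>\<^bsub>E\<^esub> \<beta>' = [h] \<cdot>\<^bsub>E\<^esub> a 1" by (simp add: elt_mult a_int_multiple)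
  qed
next
  fix h' :: int
  assume lifts: "\<forall>\<beta>'\<in>carrier E. b \<beta>' = (0, 1) \<longrightarrow> \<beta>' \<otimes>\<^bsub>E\<^esub> \<beta>' = [h'] \<cdot>\<^bsub>E\<^esub> a 1"
  have "\<beta> \<otimes>\<^bsub>E\<^esub> \<beta> = [h'] \<cdot>\<^bsub>E\<^esub> a 1" by (rule lifts[rule_format, OF lift_closed b_lift])
  then have "elt 0 h = elt 0 h'"
    by (simp add: lift_square a_int_multiple elt_0)
  then show "h' = h" by (simp add: elt_inject)
qed

section \<open>Lambda operations on elements over multiples of \<open>y\<close>\<close>

lemma lam_a: "k \<ge> 1 \<Longrightarrow> lam E k (elt 0 r) = elt 0 (sphere_coeff n' k * r)"
  using a_Lam[of k r] by (simp add: elt_0 K_sphere_red_simps)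

text \<open>Applying \<open>b\<close> determines the \<beta>-coordinate only; the
  \<alpha>-coordinate stays an unknown integer.\<close>

lemma lam_elt:
  assumes "k \<ge> 1"
  obtains r' where "lam E k (elt q r) = elt (q * sphere_coeff n k) r'"
proof -
  have "b (lam E k (elt q r)) = (0, q * sphere_coeff n k)"
    using assms by (simp add: b_lam b_elt K_sphere_lam_multiple_y)
  then show ?thesis using eltE[OF E.lam_closed[OF elt_closed]] that by blast
qed

lemma lam_lift:
  assumes "k \<ge> 1"
  obtains r where "lam E k \<beta> = elt (sphere_coeff n k) r"
  using lam_elt[OF assms, of 1 0] unfolding elt_1_0 mult_1 by blast

text \<open>Adding one more \<beta> to \<open>j \<beta>\<close> contributes the cross term
  \<open>j \<beta>\<^sup>2\<close>; summed over \<open>j < m\<close> these give the binomial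
  coefficient.\<close>

lemma lam_2_nat_multiple:
  assumes "lam E 2 \<beta> = elt s c"
  shows "lam E 2 (elt (int m) 0) = elt (int m * s) (int m * c + int (m choose 2) * h)"
proof (induction m)
  case 0
  show ?case using lam_a[of 2 0] by (simp add: binomial_eq_0)
next
  case (Suc m)
  have "elt (int (Suc m)) 0 = elt (int m) 0 \<oplus>\<^bsub>E\<^esub> elt 1 0" by (simp add: elt_add add.commute)
  then have "lam E 2 (elt (int (Suc m)) 0) =
      lam E 2 (elt (int m) 0) \<oplus>\<^bsub>E\<^esub> elt (int m) 0 \<otimes>\<^bsub>E\<^esub> elt 1 0 \<oplus>\<^bsub>E\<^esub> lam E 2 (elt 1 0)"
    by (simp add: E.lam_2_add)
  also have "\<dots> = elt (int m * s) (int m * c + int (m choose 2) * h) \<oplus>\<^bsub>E\<^esub> elt 0 (int m * h) \<oplus>\<^bsub>E\<^esub> elt s c"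
    unfolding Suc.IH elt_mult by (simp add: elt_1_0 assms elt_0)
  finally show ?case by (simp add: elt_add algebra_simps numeral_2_eq_2)
qed

text \<open>Adding one more \<beta> to \<open>j \<beta>\<close> creates two mixed terms, each equal
  to \<open>j s \<beta>\<^sup>2\<close>. Their sum over \<open>j < m\<close> is
  \<open>m (m - 1) s \<beta>\<^sup>2\<close>.\<close>

lemma lam_3_nat_multiple:
  assumes "lam E 2 \<beta> = elt s c" "lam E 3 \<beta> = elt t d"
  shows "lam E 3 (elt (int m) 0) = elt (int m * t) (int m * d + int m * (int m - 1) * s * h)"
proof (induction m)
  case 0
  show ?case using lam_a[of 3 0] by simp
next
  case (Suc m)
  have "elt (int (Suc m)) 0 = elt (int m) 0 \<oplus>\<^bsub>E\<^esub> elt 1 0" by (simp add: elt_add add.commute)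
  then have "lam E 3 (elt (int (Suc m)) 0) =
      lam E 3 (elt (int m) 0) \<oplus>\<^bsub>E\<^esub> lam E 2 (elt (int m) 0) \<otimes>\<^bsub>E\<^esub> elt 1 0
      \<oplus>\<^bsub>E\<^esub> elt (int m) 0 \<otimes>\<^bsub>E\<^esub> lam E 2 (elt 1 0) \<oplus>\<^bsub>E\<^esub> lam E 3 (elt 1 0)"
    by (simp add: E.lam_3_add)
  also have "\<dots> = elt (int m * t) (int m * d + int m * (int m - 1) * s * h)
      \<oplus>\<^bsub>E\<^esub> elt 0 (int m * s * h) \<oplus>\<^bsub>E\<^esub> elt 0 (int m * s * h) \<oplus>\<^bsub>E\<^esub> elt t d"
    unfolding Suc.IH lam_2_nat_multiple[OF assms(1)] elt_1_0 assms elt_0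
    using elt_mult[of "int m * s" _ 1 0] by (simp add: elt_mult elt_1_0)
  finally show ?case by (simp add: elt_add algebra_simps)
qed

text \<open>The \<alpha>-coordinate of \<open>\<lambda>\<^sup>2(\<lambda>\<^sup>3(\<beta>))\<close>
  is computed by additivity and by the plethysm. The factor 2 turns the binomial coefficient into a
  polynomial in \<open>w\<close>.\<close>

lemma lam_2_lam_3_relation:
  assumes "lam E 2 \<beta> = elt (sphere_coeff n 2) c2" "lam E 3 \<beta> = elt (3 ^ (n - 1)) c3"
    and "lam E 6 \<beta> = elt s6 c6"
  defines "w \<equiv> 3 ^ (n - 1) :: int"
  shows "2 * (w * c2 + sphere_coeff n' 2 * c3) + w * (w - 1) * h
    = 2 * ((sphere_coeff n 2 * sphere_coeff n 4 - sphere_coeff n 5) * h + c6)"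
proof -
  obtain c4 where c4: "lam E 4 \<beta> = elt (sphere_coeff n 4) c4" by (rule lam_lift[of 4]) simp_all
  obtain c5 where c5: "lam E 5 \<beta> = elt (sphere_coeff n 5) c5" by (rule lam_lift[of 5]) simp_all
  \<comment> \<open>The \<beta>-coordinate of \<open>\<lambda>\<^sup>3(\<beta>)\<close> is positive,
    so \<open>lam_2_nat_multiple\<close> applies directly with this natural number.\<close>
  let ?m = "3 ^ (n - 1) :: nat"
  have w: "int ?m = w" by (simp add: w_def)
  have "lam E 3 \<beta> = elt w 0 \<oplus>\<^bsub>E\<^esub> elt 0 c3" using assms(2) by (simp add: elt_add w_def)
  then have "lam E 2 (lam E 3 \<beta>) = elt (w * sphere_coeff n 2) (w * c2 + int (?m choose 2) * h)
      \<oplus>\<^bsub>E\<^esub> elt 0 0 \<oplus>\<^bsub>E\<^esub> elt 0 (sphere_coeff n' 2 * c3)"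
    using lam_2_nat_multiple[OF assms(1), of ?m, unfolded w]
    by (simp add: E.lam_2_add elt_mult lam_a flip: elt_0)
  then have l: "lam E 2 (lam E 3 \<beta>) = elt (w * sphere_coeff n 2)
      (w * c2 + int (?m choose 2) * h + sphere_coeff n' 2 * c3)"
    by (simp add: elt_add)
  have \<beta>: "\<beta> \<otimes>\<^bsub>E\<^esub> elt q r = a (q * h)" for q r using elt_mult[of 1 0 q r] by (simp add: elt_1_0)
  have "lam E 2 (lam E 3 \<beta>) = elt s6 ((sphere_coeff n 2 * sphere_coeff n 4 - sphere_coeff n 5) * h + c6)"
    unfolding E.lam_2_lam_3[OF lift_closed] unfolding c4 c5 assms(1,3) elt_mult \<beta> a_int_multiple
    by (simp only: elt_0[symmetric] elt_add) (simp add: algebra_simps)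
  then have eq: "w * c2 + int (?m choose 2) * h + sphere_coeff n' 2 * c3
      = (sphere_coeff n 2 * sphere_coeff n 4 - sphere_coeff n 5) * h + c6"
    unfolding l elt_inject by simp
  have "2 * int (k choose 2) = int k * (int k - 1)" for k
    by (induction k) (simp_all add: numeral_2_eq_2 algebra_simps)
  then have "2 * int (?m choose 2) = w * (w - 1)" unfolding w[symmetric] .
  then have "w * (w - 1) * h = 2 * (int (?m choose 2) * h)" by simp
  then show ?thesis unfolding eq[symmetric] by (simp only: distrib_left ac_simps)
qed

lemma lam_3_lam_2_relation:
  assumes "lam E 2 \<beta> = elt (- (2 ^ (n - 1))) c2" "lam E 3 \<beta> = elt (sphere_coeff n 3) c3"
    and "lam E 6 \<beta> = elt s6 c6"
  defines "m \<equiv> 2 ^ (n - 1) :: int"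
  shows "sphere_coeff n' 3 * c2 - m * c3 - m ^ 2 * (m + 1) * h
    = (sphere_coeff n 3 ^ 2 + 2 * m * sphere_coeff n 4 - sphere_coeff n 5) * h + c6"
proof -
  obtain c4 where c4: "lam E 4 \<beta> = elt (sphere_coeff n 4) c4" by (rule lam_lift[of 4]) simp_all
  obtain c5 where c5: "lam E 5 \<beta> = elt (sphere_coeff n 5) c5" by (rule lam_lift[of 5]) simp_all
  have \<beta>: "\<beta> \<otimes>\<^bsub>E\<^esub> elt q r = a (q * h)" for q r using elt_mult[of 1 0 q r] by (simp add: elt_1_0)
  \<comment> \<open>In coordinates the square has no \<beta>-part, so the plethysm term
    \<open>\<beta>\<^sup>2 \<lambda>\<^sup>4(\<beta>)\<close> vanishes by
    \<open>elt_mult\<close>.\<close>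
  have \<beta>2: "\<beta> \<otimes>\<^bsub>E\<^esub> \<beta> = elt 0 h" by (simp add: lift_square elt_0)
  let ?t = "(sphere_coeff n 3 ^ 2 + 2 * m * sphere_coeff n 4 - sphere_coeff n 5) * h + c6"
  have l: "lam E 3 (lam E 2 \<beta>) = elt s6 ?t"
    unfolding E.lam_3_lam_2[OF lift_closed] unfolding c4 c5 assms(1,2,3) \<beta>2 elt_mult \<beta> a_int_multiple
    by (simp only: elt_0[symmetric] elt_add) (simp add: algebra_simps m_def power2_eq_square)
  have m: "int (2 ^ (n - 1)) = m" by (simp add: m_def)
  \<comment> \<open>This element is only going to be multiplied by \<open>elt m 0\<close>, so its
    unknown \<alpha>-coordinate \<open>d\<close> disappears.\<close>
  obtain d where d: "lam E 2 (lam E 2 \<beta>) = elt (- m * sphere_coeff n 2) d"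
    using lam_elt[of 2 "- m" c2] assms(1) by (auto simp: m_def)
  have s2: "sphere_coeff n 2 = - m" by (simp add: m_def sphere_coeff_def)
  \<comment> \<open>Cancelling the \<open>\<beta>\<close>-part of \<open>\<lambda>\<^sup>2(\<beta>)\<close> avoids \<open>\<lambda>\<^sup>3\<close> of a negative multiple of \<open>\<beta>\<close>.\<close>
  have "elt 0 c2 = lam E 2 \<beta> \<oplus>\<^bsub>E\<^esub> elt m 0" using assms(1) by (simp add: elt_add m_def)
  then have "lam E 3 (elt 0 c2) = lam E 3 (lam E 2 \<beta>) \<oplus>\<^bsub>E\<^esub> lam E 2 (lam E 2 \<beta>) \<otimes>\<^bsub>E\<^esub> elt m 0
      \<oplus>\<^bsub>E\<^esub> lam E 2 \<beta> \<otimes>\<^bsub>E\<^esub> lam E 2 (elt m 0) \<oplus>\<^bsub>E\<^esub> lam E 3 (elt m 0)"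
    by (simp add: E.lam_3_add E.lam_closed)
  also have "\<dots> = elt s6 ?t \<oplus>\<^bsub>E\<^esub> elt 0 (m * m * m * h) \<oplus>\<^bsub>E\<^esub> elt 0 (m * m * m * h)
      \<oplus>\<^bsub>E\<^esub> elt (m * sphere_coeff n 3) (m * c3 - m * (m - 1) * m * h)"
    unfolding l d lam_2_nat_multiple[OF assms(1), of "2 ^ (n - 1)", unfolded m]
      lam_3_nat_multiple[OF assms(1,2), of "2 ^ (n - 1)", unfolded m]
    unfolding assms(1) elt_mult elt_0 s2 by (simp add: m_def mult.assoc)
  finally have "sphere_coeff n' 3 * c2 = ?t + m * m * m * h + m * m * m * h + (m * c3 - m * (m - 1) * m * h)"
    by (simp add: lam_a elt_add elt_inject)
  then show ?thesis by (simp add: algebra_simps power2_eq_square)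
qed

text \<open>Twice the second relation minus the first eliminates \<open>c6\<close> and also the
  terms with \<open>sphere_coeff n 5\<close>. Besides the terms with
  \<open>3 ^ (n - 1) * (3 ^ n - 1)\<close>, everything left is a multiple of \<open>2 ^ n\<close>
  and goes into \<open>d\<close>.\<close>

lemma hopf_relation:
  assumes "n \<ge> 1" "n' = 2 * n"
  obtains c d where "2 * (3 ^ (n - 1) * (3 ^ n - 1)) * c + 2 ^ n * d = 3 ^ (n - 1) * (3 ^ n - 1) * h"
proof -
  define m w where "m = (2 ^ (n - 1) :: int)" and "w = (3 ^ (n - 1) :: int)"
  have pow: "2 ^ n = 2 * m" "3 ^ n = 3 * w" using assms(1) by (simp_all add: m_def w_def power_eq_if)
  \<comment> \<open>The hypothesis \<open>n' = 2 * n\<close> enters here: the coefficients for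
    \<alpha> become 2 and 3 times the squares of those for \<beta>, up to sign.\<close>
  have exp: "n' - 1 = Suc ((n - 1) * 2)" using assms by simp
  have s2': "sphere_coeff n' 2 = - (2 * m ^ 2)" and s3': "sphere_coeff n' 3 = 3 * w ^ 2"
    by (simp_all add: sphere_coeff_def exp[simplified] m_def w_def power_mult)
  have s2: "sphere_coeff n 2 = - m" and s3: "sphere_coeff n 3 = w"
    by (simp_all add: sphere_coeff_def m_def w_def)
  have "(4::int) ^ (n - 1) = (2 ^ 2) ^ (n - 1)" by simp
  also have "\<dots> = m ^ 2" unfolding m_def by (simp only: power_mult[symmetric] mult.commute)
  finally have s4: "sphere_coeff n 4 = - (m ^ 2)" by (simp add: sphere_coeff_def)
  obtain c2 c3 c6 where c2: "lam E 2 \<beta> = elt (- m) c2" and c3: "lam E 3 \<beta> = elt w c3"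
    and c6: "lam E 6 \<beta> = elt (sphere_coeff n 6) c6"
    using lam_lift[of 2] lam_lift[of 3] lam_lift[of 6] s2 s3 by (metis one_le_numeral)
  have "2 * (w * c2 - 2 * m ^ 2 * c3) + w * (w - 1) * h = 2 * ((m * m ^ 2 - sphere_coeff n 5) * h + c6)"
    using lam_2_lam_3_relation[OF _ _ c6, of c2 c3] c2 c3
    unfolding s2 s2' s4 w_def[symmetric] by simp
  moreover have "3 * w ^ 2 * c2 - m * c3 - m ^ 2 * (m + 1) * h
      = (w ^ 2 - 2 * m * m ^ 2 - sphere_coeff n 5) * h + c6"
    using lam_3_lam_2_relation[OF _ _ c6, of c2 c3] c2 c3
    unfolding s3 s3' s4 m_def[symmetric] by simp
  ultimately have "2 * (w * (3 * w - 1)) * c2 + 2 * m * ((2 * m - 1) * c3 + 2 * m ^ 2 * h - m * h)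
      = w * (3 * w - 1) * h"
    by (simp add: algebra_simps power2_eq_square)
  then show ?thesis using that unfolding pow w_def[symmetric] by blast
qed

lemma odd_hopf_dvd:
  assumes "n \<ge> 1" "n' = 2 * n" "odd h"
  shows "(2::int) ^ n dvd 3 ^ n - 1"
proof -
  obtain c d where "2 * (3 ^ (n - 1) * (3 ^ n - 1)) * c + 2 ^ n * d = 3 ^ (n - 1) * (3 ^ n - 1) * h"
    using hopf_relation[OF assms(1,2)] .
  then have "2 ^ n * d = (3 ^ n - 1) * (3 ^ (n - 1) * (h - 2 * c))" by (simp add: algebra_simps)
  then have "2 ^ n dvd (3 ^ n - 1) * (3 ^ (n - 1) * (h - 2 * c))" by (metis dvd_triv_left)
  moreover have "coprime (2 ^ n) (3 ^ (n - 1) * (h - 2 * c))" using assms(3) by simp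
  ultimately show ?thesis by (simp add: coprime_dvd_mult_left_iff)
qed

end

section \<open>From a class in Ext to an extension with a chosen lift\<close>

theorem corollary8p13:
  fixes n :: nat
  assumes "n \<ge> 1"
    and "\<exists>X \<in> (Ext_lambda (K_sphere n) (K_sphere_red (2 * n)) :: (int \<times> int, int, 'e) ext set set).
           \<exists>\<xi> \<in> X. odd (hopf_invariant \<xi>)"
  shows "n = 1 \<or> n = 2 \<or> n = 4"
proof -
  obtain X and \<xi> :: "(int \<times> int, int, 'e) ext"
    where X: "X \<in> Ext_lambda (K_sphere n) (K_sphere_red (2 * n))" "\<xi> \<in> X" and odd: "odd (hopf_invariant \<xi>)"
    using assms(2) by blast
  \<comment> \<open>Members of a class are extensions themselves, because \<open>ext_equiv\<close>
    relates only extensions.\<close>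
  have "\<xi> \<in> extensions (K_sphere n) (K_sphere_red (2 * n))"
    using X unfolding Ext_lambda_def by (auto elim!: quotientE simp: ext_equiv_def)
  then obtain E a b where \<xi>: "\<xi> = (E, a, b)" and ext: "lambda_extension (K_sphere n) (K_sphere_red (2 * n)) E a b"
    unfolding extensions_def by auto
  interpret sphere_extension n "2 * n" E a b using ext by (rule sphere_extension.intro)
  have "(0, 1) \<in> b ` carrier E" unfolding b_surj by (simp add: K_sphere_simps)
  then obtain \<beta> where \<beta>: "\<beta> \<in> carrier E" "b \<beta> = (0, 1)" by force
  then obtain h where "\<beta> \<otimes>\<^bsub>E\<^esub> \<beta> = a h" by (rule square_of_lift)
  with \<beta> interpret sphere_extension_lift n "2 * n" E a b \<beta> h by unfold_locales
  have "odd h" using odd unfolding \<xi> hopf_invariant_eq .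
  then show ?thesis
    using pow2_dvd_three_power_minus_1[OF assms(1)] odd_hopf_dvd[OF assms(1) refl] by blast
qed

end
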